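(* Let $R$ be a Noetherian local ring with residue field $k$, $I$ a proper ideal of $R$, $S=R/I$, and $\varphi\colon R\twoheadrightarrow S$ the quotient map. Let $F$ be a free direct summand of $I/I^2$ as an $S$-module, and let $a_1,\dots,a_n,b_1,\dots,b_m$ be a minimal generating set of $I$ such that the classes of $a_1,\dots,a_n$ form a basis of $F$ and the classes of $b_1,\dots,b_m$ minimally generate a complement of $F$ in $I/I^2$. Let $R[X]$ be a minimal model of $\varphi$ whose set $X_1$ of degree-one variables is mapped by $\partial$ bijectively onto $\{a_1,\dots,a_n,b_1,\dots,b_m\}$, and let $x_i\in X_1$ be the variable with $\partial(x_i)=a_i$ for $1\le i\le n$. Then the elements $x_1^*,\dots,x_n^*\in\pi^2(\varphi)$ corresponding to the generators $\overline{a_1},\dots,\overline{a_n}$ of $F$ are central in the homotopy Lie algebra $\pi^*(\varphi)$; that is, $[x_i^*,u]=0$ for all $u\in\pi^*(\varphi)$ and $1\le i\le n$.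
   Context: Minimal model: a minimal model of $\varphi\colon R\to S=R/I$ is a dg algebra $R[X]$, obtained from $R$ by successively adjoining sets of free variables $X=X_1\sqcup X_2\sqcup\cdots$ ($X_i$ in degree $i$, each finite; exterior variables in odd degrees, polynomial variables in even degrees), together with a quasi-isomorphism $R[X]\to S$ of dg algebras, such that $\partial(X_1)$ is a minimal generating set of $I$ and, with $\mathfrak m_R$ the maximal ideal of $R$, $\partial(X_i)\subseteq(X,\mathfrak m_R)^2$ for $i\ge2$. Homotopy Lie algebra of $\varphi$: Put $k[X]=k\otimes_R R[X]$; by minimality its differential maps $X$ into $(X)^2$. Let $\partial^{[2]}$ be the quadratic part of the differential, i.e. for $y\in X$, $\partial^{[2]}(y)$ is the component of $\partial(y)\in k[X]$ in the span of products of two variables. As a graded vector space, $\pi^*(\varphi)=(\Sigma kX)^*$ is the graded $k$-dual of the suspension of the vector space $kX$ on the variables: $\pi^{i}(\varphi)$ has basis $\{x^*: x\in X_{i-1}\}$ dual to $X_{i-1}$, so $\pi^*(\varphi)=\pi^{\ge2}(\varphi)$. The Lie bracket is the graded-bilinear, graded-anticommutative bracket dual to $\partial^{[2]}$, i.e. to the composite of $\partial^{[2]}$ with the canonical (symmetrization) map from quadratic elements to the tensor square (using $(kX\otimes_k kX)^*\cong (kX)^*\otimes_k(kX)^*$). Explicitly, fix a total order on $X$ and write $\partial^{[2]}(y)=\sum_{x\le x'}c^{y}_{x,x'}\,x x'$ (with no terms $x^2$ for $|x|$ odd). Then, up to signs depending only on degrees (irrelevant for centrality), $[x^*,x'^*]=\pm\sum_{y}c^{y}_{x,x'}\,y^*$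 for $x<x'$, and $[x^*,x^*]=\pm 2\sum_y c^{y}_{x,x}\,y^*$ when $|x|$ is even, while $[x^*,x^*]=0$ when $|x|$ is odd. *)

theory Defs
  imports Complex_Main "HOL-Library.Multiset" "HOL-Library.Poly_Mapping"
begin

section \<open>Commutative algebra\<close>

text \<open>
  Rings are types of class \<open>comm_ring_1\<close>. The ideals of a ring are its submodules as a module over
  itself, so \<open>module.subspace\<close> and \<open>module.span\<close> for the scalar multiplication \<open>(*)\<close> give ideals and
  generated ideals.
\<close>

abbreviation ideal :: "'a::comm_ring_1 set \<Rightarrow> bool" where
  "ideal \<equiv> module.subspace (*)"

abbreviation ideal_span :: "'a::comm_ring_1 set \<Rightarrow> 'a set" where
  "ideal_span \<equiv> module.span (*)"

definition ideal_square :: "'a::comm_ring_1 set \<Rightarrow> 'a set" where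
  "ideal_square I = ideal_span {a * b | a b. a \<in> I \<and> b \<in> I}"

definition maximal_ideal :: "'a::comm_ring_1 set \<Rightarrow> bool" where
  "maximal_ideal M \<longleftrightarrow>
     ideal M \<and> M \<noteq> UNIV \<and> (\<forall>J. ideal J \<and> M \<subseteq> J \<longrightarrow> J = M \<or> J = UNIV)"

definition noetherian_local_ring :: "'a::comm_ring_1 set \<Rightarrow> bool" where
  "noetherian_local_ring \<mm> \<longleftrightarrow>
     (\<forall>J::'a set. ideal J \<longrightarrow> (\<exists>B. finite B \<and> ideal_span B = J)) \<and>
     maximal_ideal \<mm> \<and> (\<forall>M. maximal_ideal M \<longrightarrow> M = \<mm>)"

definition is_ring_hom :: "('a::comm_ring_1 \<Rightarrow> 'b::comm_ring_1) \<Rightarrow> bool" where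
  "is_ring_hom f \<longleftrightarrow> f 1 = 1 \<and> (\<forall>x y. f (x + y) = f x + f y) \<and> (\<forall>x y. f (x * y) = f x * f y)"

text \<open>
  As types cannot depend on \<open>I\<close>, a quotient \<open>R/I\<close> is any ring together with a surjective
  homomorphism from \<open>R\<close> with kernel \<open>I\<close>, and similarly for the conormal module \<open>I/I\<^sup>2\<close>.
\<close>

definition quotient_ring_map ::
    "'a::comm_ring_1 set \<Rightarrow> ('a \<Rightarrow> 'b::comm_ring_1) \<Rightarrow> bool" where
  "quotient_ring_map I \<phi> \<longleftrightarrow> is_ring_hom \<phi> \<and> surj \<phi> \<and> {r. \<phi> r = 0} = I"

text \<open>
  The \<open>S\<close>-module with scalar multiplication \<open>scale\<close> is \<open>I/I\<^sup>2\<close>, the class of \<open>a \<in> I\<close> being \<open>cl a\<close>.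
  Only the restriction of \<open>cl\<close> to \<open>I\<close> is meaningful.
\<close>

definition conormal_module ::
    "('a::comm_ring_1 \<Rightarrow> 's::comm_ring_1) \<Rightarrow> 'a set \<Rightarrow>
     ('s \<Rightarrow> 'v::ab_group_add \<Rightarrow> 'v) \<Rightarrow> ('a \<Rightarrow> 'v) \<Rightarrow> bool" where
  "conormal_module \<phi> I scale cl \<longleftrightarrow>
     module scale \<and>
     (\<forall>a\<in>I. \<forall>b\<in>I. cl (a + b) = cl a + cl b) \<and>
     (\<forall>r. \<forall>a\<in>I. cl (r * a) = scale (\<phi> r) (cl a)) \<and>
     cl ` I = UNIV \<and>
     {a \<in> I. cl a = 0} = ideal_square I"

definition complementary_submodules ::
    "('s::comm_ring_1 \<Rightarrow> 'v::ab_group_add \<Rightarrow> 'v) \<Rightarrow> 'v set \<Rightarrow> 'v set \<Rightarrow> bool" where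
  "complementary_submodules scale F G \<longleftrightarrow>
     module.subspace scale F \<and> module.subspace scale G \<and>
     F \<inter> G = {0} \<and> {f + g | f g. f \<in> F \<and> g \<in> G} = UNIV"

definition basis_of ::
    "('s::comm_ring_1 \<Rightarrow> 'v::ab_group_add \<Rightarrow> 'v) \<Rightarrow> 'v set \<Rightarrow> 'v set \<Rightarrow> bool" where
  "basis_of scale B M \<longleftrightarrow> \<not> module.dependent scale B \<and> module.span scale B = M"

definition minimally_generates ::
    "('s::comm_ring_1 \<Rightarrow> 'v::ab_group_add \<Rightarrow> 'v) \<Rightarrow> 'v set \<Rightarrow> 'v set \<Rightarrow> bool" where
  "minimally_generates scale B M \<longleftrightarrow>
     module.span scale B = M \<and> (\<forall>C. C \<subset> B \<longrightarrow> module.span scale C \<noteq> M)"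


section \<open>Free graded-commutative algebras\<close>

text \<open>
  \<open>X\<close> is a set of variables of degrees \<open>deg\<close>, exterior in odd and polynomial in even degrees. A monomial
  is a finite multiset of variables in which variables of odd degree occur at most once; it stands
  for the product of its variables in increasing order. The algebra \<open>R[X]\<close> consists of the finitely
  supported functions from monomials to \<open>R\<close>. Its product is \<open>gmult\<close> below, not the (unsigned) product
  that the type of finitely supported functions carries in the library.
\<close>

type_synonym ('x, 'a) gpoly = "'x multiset \<Rightarrow>\<^sub>0 'a"

definition monomials :: "'x set \<Rightarrow> ('x \<Rightarrow> nat) \<Rightarrow> 'x multiset set" where
  "monomials X deg = {M. set_mset M \<subseteq> X \<and> (\<forall>x. odd (deg x) \<longrightarrow> count M x \<le> 1)}"

definition mdeg :: "('x \<Rightarrow> nat) \<Rightarrow> 'x multiset \<Rightarrow> nat" where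
  "mdeg deg M = (\<Sum>x\<in>#M. deg x)"

text \<open>The sign produced by sorting the concatenation of the sorted words \<open>M\<close> and \<open>N\<close>.\<close>

definition koszul_sign ::
    "('x::linorder \<Rightarrow> nat) \<Rightarrow> 'x multiset \<Rightarrow> 'x multiset \<Rightarrow> 'a::comm_ring_1" where
  "koszul_sign deg M N =
     (-1) ^ card {(x, y). x \<in># M \<and> y \<in># N \<and> odd (deg x) \<and> odd (deg y) \<and> y < x}"

definition gmult ::
    "('x::linorder \<Rightarrow> nat) \<Rightarrow> ('x, 'a::comm_ring_1) gpoly \<Rightarrow> ('x, 'a) gpoly \<Rightarrow> ('x, 'a) gpoly" where
  "gmult deg p q =
     (\<Sum>M\<in>Poly_Mapping.keys p. \<Sum>N\<in>Poly_Mapping.keys q.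
        if M + N \<in> monomials UNIV deg
        then Poly_Mapping.single (M + N)
               (koszul_sign deg M N * Poly_Mapping.lookup p M * Poly_Mapping.lookup q N)
        else 0)"

definition gsmult :: "'a::comm_ring_1 \<Rightarrow> ('x, 'a) gpoly \<Rightarrow> ('x, 'a) gpoly" where
  "gsmult r p = Poly_Mapping.map (\<lambda>c. r * c) p"

definition gconst :: "'a::comm_ring_1 \<Rightarrow> ('x, 'a) gpoly" where
  "gconst r = Poly_Mapping.single {#} r"

definition gvar :: "'x \<Rightarrow> ('x, 'a::comm_ring_1) gpoly" where
  "gvar x = Poly_Mapping.single {#x#} 1"

definition galg :: "'x set \<Rightarrow> ('x \<Rightarrow> nat) \<Rightarrow> ('x, 'a::comm_ring_1) gpoly set" where
  "galg X deg = {p. Poly_Mapping.keys p \<subseteq> monomials X deg}"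

definition gpart :: "'x set \<Rightarrow> ('x \<Rightarrow> nat) \<Rightarrow> nat \<Rightarrow> ('x, 'a::comm_ring_1) gpoly set" where
  "gpart X deg i = {p \<in> galg X deg. \<forall>M\<in>Poly_Mapping.keys p. mdeg deg M = i}"

definition vars_in_degree :: "'x set \<Rightarrow> ('x \<Rightarrow> nat) \<Rightarrow> nat \<Rightarrow> 'x set" where
  "vars_in_degree X deg i = {x \<in> X. deg x = i}"

inductive_set gideal ::
    "'x set \<Rightarrow> ('x::linorder \<Rightarrow> nat) \<Rightarrow> ('x, 'a::comm_ring_1) gpoly set \<Rightarrow> ('x, 'a) gpoly set"
  for X :: "'x set" and deg :: "'x \<Rightarrow> nat" and G :: "('x, 'a) gpoly set" where
  gen: "g \<in> G \<Longrightarrow> g \<in> gideal X deg G"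
| zero: "0 \<in> gideal X deg G"
| add: "p \<in> gideal X deg G \<Longrightarrow> q \<in> gideal X deg G \<Longrightarrow> p + q \<in> gideal X deg G"
| left: "p \<in> galg X deg \<Longrightarrow> q \<in> gideal X deg G \<Longrightarrow> gmult deg p q \<in> gideal X deg G"
| right: "p \<in> gideal X deg G \<Longrightarrow> q \<in> galg X deg \<Longrightarrow> gmult deg p q \<in> gideal X deg G"

definition gideal_square ::
    "'x set \<Rightarrow> ('x::linorder \<Rightarrow> nat) \<Rightarrow> ('x, 'a::comm_ring_1) gpoly set \<Rightarrow> ('x, 'a) gpoly set" where
  "gideal_square X deg J = gideal X deg {gmult deg p q | p q. p \<in> J \<and> q \<in> J}"


section \<open>Differentials, quasi-isomorphisms and minimal models\<close>

text \<open>
  \<open>d\<close> is an \<open>R\<close>-linear differential of degree \<open>-1\<close> making \<open>R[X]\<close> a dg algebra. Its values outside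
  \<open>galg X deg\<close> are irrelevant.
\<close>

definition dg_differential ::
    "'x set \<Rightarrow> ('x::linorder \<Rightarrow> nat) \<Rightarrow> (('x, 'a::comm_ring_1) gpoly \<Rightarrow> ('x, 'a) gpoly) \<Rightarrow> bool" where
  "dg_differential X deg d \<longleftrightarrow>
     (\<forall>p\<in>galg X deg. \<forall>q\<in>galg X deg. d (p + q) = d p + d q) \<and>
     (\<forall>r. \<forall>p\<in>galg X deg. d (gsmult r p) = gsmult r (d p)) \<and>
     (\<forall>i. \<forall>p\<in>gpart X deg (Suc i). d p \<in> gpart X deg i) \<and>
     (\<forall>p\<in>gpart X deg 0. d p = 0) \<and>
     (\<forall>p\<in>galg X deg. d (d p) = 0) \<and>
     (\<forall>i. \<forall>p\<in>gpart X deg i. \<forall>q\<in>galg X deg.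
        d (gmult deg p q) = gmult deg (d p) q + gsmult ((-1) ^ i) (gmult deg p (d q)))"

text \<open>
  Non-negatively graded complexes, given by their components and differential, the latter being
  zero on the component of degree \<open>0\<close>. The last two clauses are injectivity and surjectivity on
  homology.
\<close>

definition cycles :: "(nat \<Rightarrow> 'c::ab_group_add set) \<Rightarrow> ('c \<Rightarrow> 'c) \<Rightarrow> nat \<Rightarrow> 'c set" where
  "cycles C d i = {z \<in> C i. d z = 0}"

definition boundaries :: "(nat \<Rightarrow> 'c::ab_group_add set) \<Rightarrow> ('c \<Rightarrow> 'c) \<Rightarrow> nat \<Rightarrow> 'c set" where
  "boundaries C d i = d ` C (Suc i)"

definition quasi_isomorphism ::
    "(nat \<Rightarrow> 'c::ab_group_add set) \<Rightarrow> ('c \<Rightarrow> 'c) \<Rightarrow>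
     (nat \<Rightarrow> 'e::ab_group_add set) \<Rightarrow> ('e \<Rightarrow> 'e) \<Rightarrow> ('c \<Rightarrow> 'e) \<Rightarrow> bool" where
  "quasi_isomorphism C d E e f \<longleftrightarrow>
     (\<forall>i. f ` C i \<subseteq> E i \<and>
        (\<forall>p\<in>C i. \<forall>q\<in>C i. f (p + q) = f p + f q) \<and>
        (\<forall>p\<in>C i. f (d p) = e (f p))) \<and>
     (\<forall>i. \<forall>z\<in>cycles C d i. f z \<in> boundaries E e i \<longrightarrow> z \<in> boundaries C d i) \<and>
     (\<forall>i. \<forall>w\<in>cycles E e i. \<exists>z\<in>cycles C d i. w - f z \<in> boundaries E e i)"

definition concentrated_in_degree_0 :: "nat \<Rightarrow> 's::comm_ring_1 set" where
  "concentrated_in_degree_0 i = (if i = 0 then UNIV else {0})"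

definition algebra_map_over ::
    "('a::comm_ring_1 \<Rightarrow> 's::comm_ring_1) \<Rightarrow> 'x set \<Rightarrow> ('x::linorder \<Rightarrow> nat) \<Rightarrow>
     (('x, 'a) gpoly \<Rightarrow> 's) \<Rightarrow> bool" where
  "algebra_map_over \<phi> X deg \<epsilon> \<longleftrightarrow>
     (\<forall>r. \<epsilon> (gconst r) = \<phi> r) \<and>
     (\<forall>p\<in>galg X deg. \<forall>q\<in>galg X deg. \<epsilon> (p + q) = \<epsilon> p + \<epsilon> q) \<and>
     (\<forall>p\<in>galg X deg. \<forall>q\<in>galg X deg. \<epsilon> (gmult deg p q) = \<epsilon> p * \<epsilon> q)"

text \<open>
  \<open>R[X]\<close> with differential \<open>d\<close> and augmentation \<open>\<epsilon>\<close> is a minimal model of \<open>\<phi> : R \<rightarrow> R/I\<close>. That \<open>R[X]\<close>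
  arises by successively adjoining the variables in degrees \<open>1, 2, \<dots>\<close> is automatic:
  for degree reasons \<open>d x\<close> only involves variables of degree smaller than that of \<open>x\<close>.
  Elements of \<open>gpart X deg 0\<close> are constants, and their coefficient at \<open>{#}\<close> is the
  corresponding element of \<open>R\<close>.
\<close>

definition minimal_model ::
    "'a::comm_ring_1 set \<Rightarrow> 'a set \<Rightarrow> ('a \<Rightarrow> 's::comm_ring_1) \<Rightarrow>
     'x set \<Rightarrow> ('x::linorder \<Rightarrow> nat) \<Rightarrow>
     (('x, 'a) gpoly \<Rightarrow> ('x, 'a) gpoly) \<Rightarrow> (('x, 'a) gpoly \<Rightarrow> 's) \<Rightarrow> bool" where
  "minimal_model \<mm> I \<phi> X deg d \<epsilon> \<longleftrightarrow>
     (\<forall>x\<in>X. 1 \<le> deg x) \<and> (\<forall>i. finite (vars_in_degree X deg i)) \<and>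
     dg_differential X deg d \<and>
     algebra_map_over \<phi> X deg \<epsilon> \<and>
     quasi_isomorphism (gpart X deg) d concentrated_in_degree_0 (\<lambda>_. 0) \<epsilon> \<and>
     inj_on (\<lambda>x. d (gvar x)) (vars_in_degree X deg 1) \<and>
     minimally_generates (*)
       ((\<lambda>x. Poly_Mapping.lookup (d (gvar x)) {#}) ` vars_in_degree X deg 1) I \<and>
     (\<forall>x\<in>X. 2 \<le> deg x \<longrightarrow>
        d (gvar x) \<in> gideal_square X deg (gideal X deg (gvar ` X \<union> gconst ` \<mm>)))"


section \<open>The homotopy Lie algebra\<close>

text \<open>The base change map \<open>R[X] \<rightarrow> k[X]\<close> along \<open>\<rho> : R \<rightarrow> k\<close>.\<close>

definition base_change ::
    "('a::comm_ring_1 \<Rightarrow> 'k::field) \<Rightarrow> ('x, 'a) gpoly \<Rightarrow> ('x, 'k) gpoly" where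
  "base_change \<rho> p = Poly_Mapping.map \<rho> p"

definition quadratic_part :: "('x, 'k::comm_ring_1) gpoly \<Rightarrow> ('x, 'k) gpoly" where
  "quadratic_part p =
     (\<Sum>M\<in>{M \<in> Poly_Mapping.keys p. size M = 2}. Poly_Mapping.single M (Poly_Mapping.lookup p M))"

text \<open>
  The coefficient of \<open>x \<otimes> x'\<close> in the image of a quadratic element under the symmetrization map
  \<open>x x' \<mapsto> x \<otimes> x' + (-1)\<^bsup>|x||x'|\<^esup> x' \<otimes> x\<close>. For \<open>x = x'\<close> of even degree it is twice the coefficient
  of \<open>x\<^sup>2\<close>.
\<close>

definition symmetrization_coeff ::
    "('x::linorder \<Rightarrow> nat) \<Rightarrow> ('x, 'k::comm_ring_1) gpoly \<Rightarrow> 'x \<Rightarrow> 'x \<Rightarrow> 'k" where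
  "symmetrization_coeff deg q x x' =
     (if x \<le> x' then Poly_Mapping.lookup q {#x, x'#} else 0) +
     (if x' \<le> x then (-1) ^ (deg x * deg x') * Poly_Mapping.lookup q {#x, x'#} else 0)"

text \<open>
  The graded dual of \<open>\<Sigma>kX\<close> consists of the finite linear combinations of the dual basis vectors \<open>x\<^sup>*\<close>,
  because there are finitely many variables in each degree. It is encoded by coefficient functions;
  \<open>x\<^sup>*\<close> has degree \<open>deg x + 1\<close>.
\<close>

definition homotopy_lie_algebra :: "'x set \<Rightarrow> ('x \<Rightarrow>\<^sub>0 'k::field) set" where
  "homotopy_lie_algebra X = {u. Poly_Mapping.keys u \<subseteq> X}"

definition dual_var :: "'x \<Rightarrow> 'x \<Rightarrow>\<^sub>0 'k::field" where
  "dual_var x = Poly_Mapping.single x 1"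

text \<open>
  The bracket of two dual basis vectors. For degree reasons only variables \<open>y\<close> of degree
  \<open>deg x + deg x' + 1\<close> contribute. The sign is that of Felix, Halperin and Thomas (Rational Homotopy
  Theory, Section 21(e)), \<open>\<langle>y; s[\<alpha>, \<beta>]\<rangle> = (-1)\<^bsup>|\<beta>| + 1\<^esup> \<langle>\<partial>\<^bsup>[2]\<^esup> y; s\<alpha>, s\<beta>\<rangle>\<close>; it gives
  \<open>[v, u] = -(-1)\<^bsup>|u||v|\<^esup> [u, v]\<close>.
\<close>

definition basis_bracket ::
    "('a::comm_ring_1 \<Rightarrow> 'k::field) \<Rightarrow> 'x set \<Rightarrow> ('x::linorder \<Rightarrow> nat) \<Rightarrow>
     (('x, 'a) gpoly \<Rightarrow> ('x, 'a) gpoly) \<Rightarrow> 'x \<Rightarrow> 'x \<Rightarrow> 'x \<Rightarrow>\<^sub>0 'k" where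
  "basis_bracket \<rho> X deg d x x' =
     (\<Sum>y\<in>vars_in_degree X deg (deg x + deg x' + 1).
        Poly_Mapping.single y
          ((-1) ^ ((deg x + 1) * deg x') *
           symmetrization_coeff deg (quadratic_part (base_change \<rho> (d (gvar y)))) x x'))"

definition lie_bracket ::
    "('a::comm_ring_1 \<Rightarrow> 'k::field) \<Rightarrow> 'x set \<Rightarrow> ('x::linorder \<Rightarrow> nat) \<Rightarrow>
     (('x, 'a) gpoly \<Rightarrow> ('x, 'a) gpoly) \<Rightarrow> ('x \<Rightarrow>\<^sub>0 'k) \<Rightarrow> ('x \<Rightarrow>\<^sub>0 'k) \<Rightarrow> 'x \<Rightarrow>\<^sub>0 'k" where
  "lie_bracket \<rho> X deg d u v =
     (\<Sum>x\<in>Poly_Mapping.keys u. \<Sum>x'\<in>Poly_Mapping.keys v.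
        Poly_Mapping.map (\<lambda>c. Poly_Mapping.lookup u x * Poly_Mapping.lookup v x' * c)
          (basis_bracket \<rho> X deg d x x'))"

definition central ::
    "('a::comm_ring_1 \<Rightarrow> 'k::field) \<Rightarrow> 'x set \<Rightarrow> ('x::linorder \<Rightarrow> nat) \<Rightarrow>
     (('x, 'a) gpoly \<Rightarrow> ('x, 'a) gpoly) \<Rightarrow> ('x \<Rightarrow>\<^sub>0 'k) \<Rightarrow> bool" where
  "central \<rho> X deg d z \<longleftrightarrow>
     z \<in> homotopy_lie_algebra X \<and>
     (\<forall>u\<in>homotopy_lie_algebra X. lie_bracket \<rho> X deg d z u = 0)"

end

theory Submission
  imports Defs
begin

text \<open>
  Let \<open>x\<^sub>1\<close> be the variable of a basis element \<open>a\<^sub>1\<close> of the free summand. The projection of \<open>I/I\<^sup>2\<close> onto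
  the coordinate of \<open>a\<^sub>1\<close> lifts to an \<open>R\<close>-linear derivation \<open>\<theta>\<close> of \<open>R[X]\<close> of degree \<open>-1\<close> with \<open>\<theta> x\<^sub>1 = 1\<close>,
  killing the other variables of degree \<open>1\<close>, and with \<open>\<partial>\<theta> = -\<theta>\<partial>\<close>. Its values are found by induction on
  the degree: for \<open>|y| \<ge> 3\<close> the cycle \<open>\<theta>(\<partial>y)\<close> is a boundary because \<open>R[X]\<close> is a resolution, and for
  \<open>|y| = 2\<close> because in any relation between the chosen generators of \<open>I\<close> the coefficient of \<open>a\<^sub>1\<close> lies in
  \<open>I\<close>. By minimality \<open>\<partial>(\<theta> y)\<close> has no linear part modulo \<open>\<mm>\<close>, while the coefficient of \<open>x'\<close> in
  \<open>\<theta>(\<partial>y)\<close> is, up to sign and modulo \<open>\<mm>\<close>, the coefficient of \<open>x\<^sub>1 x'\<close> in \<open>\<partial>y\<close>. So the latter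
  vanishes in \<open>k\<close>.
\<close>

abbreviation gmono :: "'x multiset \<Rightarrow> 'a::zero \<Rightarrow> 'x multiset \<Rightarrow>\<^sub>0 'a" where
  "gmono \<equiv> Poly_Mapping.single"

abbreviation cf :: "('x multiset \<Rightarrow>\<^sub>0 'a::zero) \<Rightarrow> 'x multiset \<Rightarrow> 'a" where
  "cf \<equiv> Poly_Mapping.lookup"

section \<open>Signs\<close>

text \<open>
  Counting variables with multiplicity makes this sign bimultiplicative without side conditions.
\<close>

definition sort_sign :: "('x::linorder \<Rightarrow> nat) \<Rightarrow> 'x multiset \<Rightarrow> 'x multiset \<Rightarrow> 'a::comm_ring_1" where
  "sort_sign deg M N =
     (\<Prod>x\<in>#M. \<Prod>y\<in>#N. if odd (deg x) \<and> odd (deg y) \<and> y < x then -1 else 1)"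

lemma sort_sign_empty [simp]: "sort_sign deg {#} N = 1" "sort_sign deg M {#} = 1"
  by (simp_all add: sort_sign_def)

lemma sort_sign_add_left: "sort_sign deg (M + M') N = sort_sign deg M N * sort_sign deg M' N"
  by (simp add: sort_sign_def)

lemma sort_sign_add_right: "sort_sign deg M (N + N') = sort_sign deg M N * sort_sign deg M N'"
  by (simp add: sort_sign_def prod_mset.distrib)

lemma sort_sign_add_mset_left:
  "sort_sign deg (add_mset x M) N = sort_sign deg {#x#} N * sort_sign deg M N"
  using sort_sign_add_left[of deg "{#x#}" M N] by simp

lemma sort_sign_add_mset_right:
  "sort_sign deg M (add_mset x N) = sort_sign deg M {#x#} * sort_sign deg M N"
  using sort_sign_add_right[of deg M "{#x#}" N] by simp

lemma sort_sign_square: "sort_sign deg M N * sort_sign deg M N = (1 :: 'a::comm_ring_1)"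
proof (induction M)
  case (add x M)
  have "sort_sign deg {#x#} N * sort_sign deg {#x#} N = (1 :: 'a)"
    by (induction N) (simp_all add: sort_sign_def algebra_simps)
  with add show ?case
    by (simp add: sort_sign_add_mset_left[of deg x M] algebra_simps flip: mult.assoc)
qed simp

lemma monomials_subset:
  assumes "M \<in> monomials X deg" "N \<subseteq># M"
  shows "N \<in> monomials X deg"
proof -
  have "count N x \<le> count M x" for x
    using assms(2) by (simp add: subseteq_mset_def)
  then show ?thesis
    using assms set_mset_mono[OF assms(2)] unfolding monomials_def
    by (auto intro: le_trans[OF \<open>count N _ \<le> count M _\<close>])
qed

lemma monomials_UNIV: "M \<in> monomials X deg \<Longrightarrow> M \<in> monomials UNIV deg"
  by (simp add: monomials_def)

lemma monomials_iff: "M \<in> monomials X deg \<longleftrightarrow> M \<in> monomials UNIV deg \<and> set_mset M \<subseteq> X"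
  by (auto simp: monomials_def)

text \<open>Entries of multiplicity one contribute equally to both products, and repeated entries
  contribute 1. This prepares the comparison of the product \<open>sort_sign\<close> with the set of
  pairs counted by \<open>koszul_sign\<close>.\<close>

lemma prod_mset_eq_prod_set:
  fixes f :: "'b \<Rightarrow> 'a::comm_monoid_mult"
  assumes "\<And>x. count M x \<ge> 2 \<Longrightarrow> f x = 1"
  shows "(\<Prod>x\<in>#M. f x) = (\<Prod>x\<in>set_mset M. f x)"
proof -
  have "(\<Prod>x\<in>#M. f x) = (\<Prod>x\<in>set_mset M. f x ^ count M x)"
    by (rule image_prod_mset_multiplicity)
  also have "\<dots> = (\<Prod>x\<in>set_mset M. f x)"
  proof (rule prod.cong[OF refl])
    fix x assume "x \<in> set_mset M"
    then have "count M x = 1 \<or> count M x \<ge> 2"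
      by (metis One_nat_def Suc_1 Suc_leI count_greater_zero_iff le_neq_implies_less)
    then show "f x ^ count M x = f x" using assms by auto
  qed
  finally show ?thesis .
qed

text \<open>In a monomial only even variables are repeated, and an even variable contributes the
  factor 1 everywhere. Hence counting pairs with or without multiplicity gives the same
  sign.\<close>

lemma koszul_sign_eq_sort_sign:
  assumes "M \<in> monomials UNIV deg" "N \<in> monomials UNIV deg"
  shows "koszul_sign deg M N = (sort_sign deg M N :: 'a::comm_ring_1)"
proof -
  let ?c = "\<lambda>x y. odd (deg x) \<and> odd (deg y) \<and> y < x"
  have odd_count: "odd (deg x) \<Longrightarrow> count M x \<le> 1" "odd (deg x) \<Longrightarrow> count N x \<le> 1" for x
    using assms by (auto simp: monomials_def)
  have "sort_sign deg M N =
      (\<Prod>x\<in>set_mset M. \<Prod>y\<in>#N. if ?c x y then -1 else (1::'a))"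
    unfolding sort_sign_def
  proof (rule prod_mset_eq_prod_set)
    fix x assume "2 \<le> count M x"
    with odd_count[of x] have "even (deg x)" by fastforce
    then show "(\<Prod>y\<in>#N. if ?c x y then -1 else (1::'a)) = 1" by simp
  qed
  also have "\<dots> = (\<Prod>x\<in>set_mset M. \<Prod>y\<in>set_mset N. if ?c x y then -1 else 1)"
  proof (rule prod.cong[OF refl], rule prod_mset_eq_prod_set)
    fix x y assume "2 \<le> count N y"
    with odd_count[of y] have "even (deg y)" by fastforce
    then show "(if ?c x y then -1 else (1::'a)) = 1" by simp
  qed
  also have "\<dots> = (\<Prod>(x, y)\<in>set_mset M \<times> set_mset N. if ?c x y then -1 else 1)"
    by (rule prod.cartesian_product)
  also have "\<dots> = (\<Prod>z\<in>(set_mset M \<times> set_mset N) \<inter> {(x, y). ?c x y}. -1)"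
    by (subst prod.inter_restrict) (auto intro!: prod.cong)
  also have "\<dots> = (-1) ^ card {(x, y). x \<in># M \<and> y \<in># N \<and> ?c x y}"
    by (auto intro!: arg_cong[where f = "\<lambda>S. (-1) ^ card S"])
  finally show ?thesis unfolding koszul_sign_def by simp
qed

lemma mdeg_empty [simp]: "mdeg deg {#} = 0"
  and mdeg_add_mset [simp]: "mdeg deg (add_mset x M) = deg x + mdeg deg M"
  and mdeg_add [simp]: "mdeg deg (M + N) = mdeg deg M + mdeg deg N"
  by (simp_all add: mdeg_def)

text \<open>A pair of distinct odd variables, one from each multiset, is out of order in exactly one
  of the two concatenations; a common odd variable would be counted in neither, which the assumption
  excludes. The number of odd pairs has the parity of the product of the degrees.\<close>

lemma sort_sign_commute:
  assumes "\<And>x. x \<in># M \<Longrightarrow> x \<in># N \<Longrightarrow> even (deg x)"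
  shows "sort_sign deg M N * sort_sign deg N M = ((-1) ^ (mdeg deg M * mdeg deg N) :: 'a::comm_ring_1)"
  using assms
proof (induction M)
  case (add x M)
  have "sort_sign deg {#x#} N * sort_sign deg N {#x#} = ((-1) ^ (deg x * mdeg deg N) :: 'a)"
    if "x \<in># N \<Longrightarrow> even (deg x)" using that
  proof (induction N)
    case (add y N)
    have "sort_sign deg {#x#} {#y#} * sort_sign deg {#y#} {#x#} = ((-1) ^ (deg x * deg y) :: 'a)"
      using add.prems by (cases x y rule: linorder_cases) (auto simp: sort_sign_def)
    moreover have "sort_sign deg {#x#} (add_mset y N) * sort_sign deg (add_mset y N) {#x#} =
        (sort_sign deg {#x#} {#y#} * sort_sign deg {#y#} {#x#}) *
        (sort_sign deg {#x#} N * sort_sign deg N {#x#} :: 'a)"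
      by (simp only: sort_sign_add_mset_left[of deg y N] sort_sign_add_mset_right[of deg _ y N]
          mult_ac)
    moreover have "sort_sign deg {#x#} N * sort_sign deg N {#x#} = ((-1) ^ (deg x * mdeg deg N) :: 'a)"
      using add by auto
    ultimately show ?case by (simp only: mdeg_add_mset distrib_left power_add)
  qed simp
  then have "sort_sign deg {#x#} N * sort_sign deg N {#x#} = ((-1) ^ (deg x * mdeg deg N) :: 'a)"
    using add.prems by auto
  moreover have "sort_sign deg (add_mset x M) N * sort_sign deg N (add_mset x M) =
      (sort_sign deg {#x#} N * sort_sign deg N {#x#}) *
      (sort_sign deg M N * sort_sign deg N M :: 'a)"
    by (simp only: sort_sign_add_mset_left[of deg x M] sort_sign_add_mset_right[of deg _ x M]
        mult_ac)
  moreover have "sort_sign deg M N * sort_sign deg N M = ((-1) ^ (mdeg deg M * mdeg deg N) :: 'a)"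
    using add by auto
  ultimately show ?case by (simp only: mdeg_add_mset distrib_right power_add)
qed simp

text \<open>The structure constants of \<open>gmult\<close> with respect to monomials.\<close>

definition mono_coeff :: "('x::linorder \<Rightarrow> nat) \<Rightarrow> 'x multiset \<Rightarrow> 'x multiset \<Rightarrow> 'a::comm_ring_1" where
  "mono_coeff deg M N = (if M + N \<in> monomials UNIV deg then sort_sign deg M N else 0)"

lemma monomials_addD:
  assumes "M + N \<in> monomials X deg"
  shows "M \<in> monomials X deg" "N \<in> monomials X deg"
  using monomials_subset[OF assms] by simp_all

text \<open>If \<open>M + N + P\<close> is not a monomial, the second factor on each side is 0.
  Otherwise bimultiplicativity makes both sides the product of the three pairwise signs.\<close>

lemma mono_coeff_assoc:
  "mono_coeff deg M N * mono_coeff deg (M + N) P =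
   (mono_coeff deg N P * mono_coeff deg M (N + P) :: 'a::comm_ring_1)"
proof (cases "M + N + P \<in> monomials UNIV deg")
  case True
  moreover from True have "M + N \<in> monomials UNIV deg" "N + P \<in> monomials UNIV deg"
    using monomials_addD(1)[of "M + N" P UNIV deg] monomials_addD(2)[of M "N + P" UNIV deg]
    by (simp_all add: add.assoc)
  ultimately show ?thesis
    by (simp add: mono_coeff_def sort_sign_add_left sort_sign_add_right add.assoc mult_ac)
next
  case False
  then show ?thesis by (simp add: mono_coeff_def add.assoc)
qed

lemma monomials_add_even:
  assumes "M + N \<in> monomials X deg" "x \<in># M" "x \<in># N"
  shows "even (deg x)"
proof (rule ccontr)
  assume "odd (deg x)"
  then have "count (M + N) x \<le> 1" using assms(1) by (auto simp: monomials_def)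
  moreover have "count M x \<ge> 1" "count N x \<ge> 1" using assms(2,3) by (simp_all add: Suc_le_eq)
  ultimately show False by simp
qed

text \<open>The identity \<open>sort_sign_commute\<close> is multiplied by the second sign, which
  squares to 1. Its assumption holds because a variable shared by the two factors of a monomial is
  even.\<close>

lemma mono_coeff_commute:
  "mono_coeff deg M N = ((-1) ^ (mdeg deg M * mdeg deg N) * mono_coeff deg N M :: 'a::comm_ring_1)"
proof (cases "M + N \<in> monomials UNIV deg")
  case True
  have "sort_sign deg M N * (sort_sign deg N M * sort_sign deg N M) =
      ((-1) ^ (mdeg deg M * mdeg deg N) * sort_sign deg N M :: 'a)"
    using sort_sign_commute[of M N deg, where 'a = 'a] monomials_add_even[OF True]
    by (simp flip: mult.assoc)
  with True show ?thesis
    by (simp add: mono_coeff_def sort_sign_square add.commute)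
qed (simp add: mono_coeff_def add.commute)

lemma mono_coeff_square:
  "M + N \<in> monomials UNIV deg \<Longrightarrow> mono_coeff deg M N * mono_coeff deg M N = (1 :: 'a::comm_ring_1)"
  by (simp add: mono_coeff_def sort_sign_square)


section \<open>The algebra of graded polynomials\<close>

text \<open>Enlarging the index sets beyond the supports lets several products be summed over the
  same sets, which is what additivity needs.\<close>

lemma gmult_eq_sum:
  assumes "finite A" "finite B" "Poly_Mapping.keys p \<subseteq> A" "Poly_Mapping.keys q \<subseteq> B"
  shows "gmult deg p q = (\<Sum>M\<in>A. \<Sum>N\<in>B. gmono (M + N) (mono_coeff deg M N * cf p M * cf q N))"
proof -
  have "gmult deg p q = (\<Sum>M\<in>Poly_Mapping.keys p. \<Sum>N\<in>Poly_Mapping.keys q.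
      gmono (M + N) (mono_coeff deg M N * cf p M * cf q N))"
    unfolding gmult_def mono_coeff_def
    by (intro sum.cong refl) (simp add: koszul_sign_eq_sort_sign[OF monomials_addD])
  also have "\<dots> = (\<Sum>M\<in>Poly_Mapping.keys p. \<Sum>N\<in>B. gmono (M + N) (mono_coeff deg M N * cf p M * cf q N))"
    using assms by (intro sum.cong refl sum.mono_neutral_left) (auto simp: in_keys_iff)
  also have "\<dots> = (\<Sum>M\<in>A. \<Sum>N\<in>B. gmono (M + N) (mono_coeff deg M N * cf p M * cf q N))"
    using assms by (intro sum.mono_neutral_left) (auto simp: in_keys_iff)
  finally show ?thesis .
qed

lemma gmult_add_left: "gmult deg (p + p') q = gmult deg p q + gmult deg p' q"
proof -
  let ?A = "Poly_Mapping.keys p \<union> Poly_Mapping.keys p'"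
  have "Poly_Mapping.keys (p + p') \<subseteq> ?A" by (rule Poly_Mapping.keys_add)
  then show ?thesis
    by (simp add: gmult_eq_sum[of ?A "Poly_Mapping.keys q"] lookup_add distrib_left distrib_right
        single_add sum.distrib)
qed

lemma gmult_add_right: "gmult deg p (q + q') = gmult deg p q + gmult deg p q'"
proof -
  let ?A = "Poly_Mapping.keys q \<union> Poly_Mapping.keys q'"
  have "Poly_Mapping.keys (q + q') \<subseteq> ?A" by (rule Poly_Mapping.keys_add)
  then show ?thesis
    by (simp add: gmult_eq_sum[of "Poly_Mapping.keys p" ?A] lookup_add distrib_left
        single_add sum.distrib)
qed

lemma gmult_zero [simp]: "gmult deg 0 q = 0" "gmult deg p 0 = 0"
  by (simp_all add: gmult_def)

lemma gmult_mono: "gmult deg (gmono M r) (gmono N s) = gmono (M + N) (mono_coeff deg M N * r * s)"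
  using gmult_eq_sum[of "{M}" "{N}" "gmono M r" "gmono N s" deg] by simp

lemma gmult_sum_mset_left: "gmult deg (\<Sum>i\<in>#A. f i) q = (\<Sum>i\<in>#A. gmult deg (f i) q)"
  by (induction A) (simp_all add: gmult_add_left)

lemma gmult_sum_mset_right: "gmult deg p (\<Sum>i\<in>#A. f i) = (\<Sum>i\<in>#A. gmult deg p (f i))"
  by (induction A) (simp_all add: gmult_add_right)

lemma sum_mono_cf: "(\<Sum>M\<in>Poly_Mapping.keys p. gmono M (cf p M)) = p"
proof (rule poly_mapping_eqI)
  fix N
  show "cf (\<Sum>M\<in>Poly_Mapping.keys p. gmono M (cf p M)) N = cf p N"
    by (cases "N \<in> Poly_Mapping.keys p")
       (simp_all add: lookup_sum lookup_single when_def in_keys_iff)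
qed

text \<open>Retaining \<open>M \<in> Poly_Mapping.keys p\<close> in the monomial case transfers
  hypotheses on \<open>p\<close>, such as its degree, to its monomials, while the coefficient stays
  arbitrary.\<close>

lemma gpoly_induct [case_names zero mono add]:
  assumes "P 0"
    and "\<And>M r. M \<in> Poly_Mapping.keys p \<Longrightarrow> P (gmono M r)"
    and "\<And>q q'. P q \<Longrightarrow> P q' \<Longrightarrow> P (q + q')"
  shows "P (p :: ('x, 'a::comm_ring_1) gpoly)"
proof -
  have "P (\<Sum>M\<in>A. gmono M (cf p M))" if "A \<subseteq> Poly_Mapping.keys p" for A
    using finite_subset[OF that finite_keys] that
    by (induction A rule: finite_induct) (auto intro: assms)
  from this[OF order_refl] show ?thesis by (simp add: sum_mono_cf)
qed

lemma gmult_assoc: "gmult deg (gmult deg p q) r = gmult deg p (gmult deg q r)"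
proof (induction p rule: gpoly_induct)
  case p: (mono M c)
  show ?case
  proof (induction q rule: gpoly_induct)
    case q: (mono N c')
    show ?case
    proof (induction r rule: gpoly_induct)
      case (mono P c'')
      have "mono_coeff deg (M + N) P * (mono_coeff deg M N * c * c') * c'' =
          (mono_coeff deg M N * mono_coeff deg (M + N) P) * (c * c' * c'')"
        by (simp only: mult_ac)
      then show ?case
        unfolding mono_coeff_assoc by (simp add: gmult_mono add.assoc mult_ac)
    qed (simp_all add: gmult_add_right)
  qed (simp_all add: gmult_add_left gmult_add_right)
qed (simp_all add: gmult_add_left)

lemma cf_gsmult [simp]: "cf (gsmult r p) M = r * cf p M"
  by (simp add: gsmult_def Poly_Mapping.map.rep_eq when_def)

lemma gsmult_add: "gsmult r (p + q) = gsmult r p + gsmult r q"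
  by (rule poly_mapping_eqI) (simp add: lookup_add distrib_left)

lemma gsmult_mono [simp]: "gsmult r (gmono M c) = gmono M (r * c)"
  by (simp add: gsmult_def)

lemma gsmult_zero [simp]: "gsmult r 0 = 0"
  by (rule poly_mapping_eqI) simp

lemma gsmult_minus_one [simp]: "gsmult (-1) p = - p"
  by (rule poly_mapping_eqI) simp

lemma gsmult_gsmult [simp]: "gsmult r (gsmult s p) = gsmult (r * s) p"
  by (rule poly_mapping_eqI) (simp add: mult_ac)

lemma gmult_gsmult_left: "gmult deg (gsmult r p) q = gsmult r (gmult deg p q)"
proof (induction p rule: gpoly_induct)
  case (mono M c)
  show ?case
    by (induction q rule: gpoly_induct) (simp_all add: gmult_mono gmult_add_right gsmult_add mult_ac)
qed (simp_all add: gmult_add_left gsmult_add)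

lemma gmult_gsmult_right: "gmult deg p (gsmult r q) = gsmult r (gmult deg p q)"
proof (induction p rule: gpoly_induct)
  case (mono M c)
  show ?case
    by (induction q rule: gpoly_induct) (simp_all add: gmult_mono gmult_add_right gsmult_add mult_ac)
qed (simp_all add: gmult_add_left gsmult_add)

lemma gmult_commute:
  assumes "p \<in> gpart X deg i" "q \<in> gpart Y deg j"
  shows "gmult deg p q = gsmult ((-1) ^ (i * j)) (gmult deg q p)"
proof (induction p rule: gpoly_induct)
  case p: (mono M c)
  show ?case
  proof (induction q rule: gpoly_induct)
    case q: (mono N c')
    from p q assms have "mdeg deg M = i" "mdeg deg N = j" by (auto simp: gpart_def)
    then show ?case
      by (simp add: gmult_mono add.commute mult_ac mono_coeff_commute[of deg M N])
  qed (simp_all add: gmult_add_left gmult_add_right gsmult_add)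
qed (simp_all add: gmult_add_left gmult_add_right gsmult_add)


section \<open>Elements of \<open>R[X]\<close> and its graded pieces\<close>

lemma galg_zero [simp]: "0 \<in> galg X deg"
  by (simp add: galg_def)

lemma galg_add [intro]: "p \<in> galg X deg \<Longrightarrow> q \<in> galg X deg \<Longrightarrow> p + q \<in> galg X deg"
  using Poly_Mapping.keys_add[of p q] by (auto simp: galg_def)

lemma galg_sum: "(\<And>i. i \<in> A \<Longrightarrow> f i \<in> galg X deg) \<Longrightarrow> (\<Sum>i\<in>A. f i) \<in> galg X deg"
  by (induction A rule: infinite_finite_induct) auto

lemma galg_gmono: "r = 0 \<or> M \<in> monomials X deg \<Longrightarrow> gmono M r \<in> galg X deg"
  by (auto simp: galg_def)

lemma galg_gsmult: "p \<in> galg X deg \<Longrightarrow> gsmult r p \<in> galg X deg"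
proof -
  have "Poly_Mapping.keys (gsmult r p) \<subseteq> Poly_Mapping.keys p"
    by (auto simp: in_keys_iff)
  then show "p \<in> galg X deg \<Longrightarrow> gsmult r p \<in> galg X deg"
    by (auto simp: galg_def)
qed

lemma galg_subset: "Y \<subseteq> X \<Longrightarrow> galg Y deg \<subseteq> galg X deg"
  by (auto simp: galg_def monomials_def)

lemma gpart_iff:
  "p \<in> gpart X deg i \<longleftrightarrow> (\<forall>M\<in>Poly_Mapping.keys p. M \<in> monomials X deg \<and> mdeg deg M = i)"
  by (auto simp: gpart_def galg_def)

lemma gpart_galg: "p \<in> gpart X deg i \<Longrightarrow> p \<in> galg X deg"
  by (simp add: gpart_def)

lemma gpart_zero [simp]: "0 \<in> gpart X deg i"
  by (simp add: gpart_iff)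

lemma gpart_add [intro]: "p \<in> gpart X deg i \<Longrightarrow> q \<in> gpart X deg i \<Longrightarrow> p + q \<in> gpart X deg i"
  using Poly_Mapping.keys_add[of p q] unfolding gpart_iff by blast

lemma gpart_uminus: "p \<in> gpart X deg i \<Longrightarrow> - p \<in> gpart X deg i"
  by (simp add: gpart_iff)

lemma gpart_gmono: "r = 0 \<or> M \<in> monomials X deg \<and> mdeg deg M = i \<Longrightarrow> gmono M r \<in> gpart X deg i"
  by (auto simp: gpart_iff)

lemma gpart_sum: "(\<And>i. i \<in> A \<Longrightarrow> f i \<in> gpart X deg n) \<Longrightarrow> (\<Sum>i\<in>A. f i) \<in> gpart X deg n"
  by (induction A rule: infinite_finite_induct) auto

lemma gpart_sum_mset: "(\<And>i. i \<in># A \<Longrightarrow> f i \<in> gpart X deg n) \<Longrightarrow> (\<Sum>i\<in>#A. f i) \<in> gpart X deg n"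
  by (induction A) auto

lemma gmult_gpart:
  fixes p q :: "('x::linorder, 'a::comm_ring_1) gpoly"
  assumes "p \<in> gpart X deg i" "q \<in> gpart X deg j"
  shows "gmult deg p q \<in> gpart X deg (i + j)"
proof (induction p rule: gpoly_induct)
  case p: (mono M c)
  show ?case
  proof (induction q rule: gpoly_induct)
    case q: (mono N c')
    have "M + N \<in> monomials X deg \<and> mdeg deg (M + N) = i + j"
      if "mono_coeff deg M N \<noteq> (0 :: 'a)"
    proof -
      have "set_mset M \<subseteq> X" "mdeg deg M = i" "set_mset N \<subseteq> X" "mdeg deg N = j"
        using p q assms by (auto simp: gpart_iff monomials_def)
      then show ?thesis
        using that by (auto simp: mono_coeff_def monomials_iff[of _ X] split: if_splits)
    qed
    then show ?case
      unfolding gmult_mono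
      by (intro gpart_gmono) (cases "mono_coeff deg M N = (0 :: 'a)", simp_all)
  qed (auto simp: gmult_add_right)
qed (auto simp: gmult_add_left)

lemma gmult_galg:
  assumes "p \<in> galg X deg" "q \<in> galg X deg"
  shows "gmult deg p q \<in> galg X deg"
proof (induction p rule: gpoly_induct)
  case p: (mono M c)
  show ?case
  proof (induction q rule: gpoly_induct)
    case q: (mono N c')
    have "gmono M c \<in> gpart X deg (mdeg deg M)" "gmono N c' \<in> gpart X deg (mdeg deg N)"
      using p q assms by (auto intro!: gpart_gmono simp: galg_def)
    then show ?case by (blast intro: gmult_gpart gpart_galg)
  qed (auto simp: gmult_add_right)
qed (auto simp: gmult_add_left)


section \<open>Derivations of degree -1\<close>

text \<open>The \<open>R\<close>-linear derivation of degree \<open>-1\<close> with prescribed values \<open>t z\<close> on the variables \<open>z\<close>.\<close>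

definition der ::
    "('x::linorder \<Rightarrow> nat) \<Rightarrow> ('x \<Rightarrow> ('x, 'a::comm_ring_1) gpoly) \<Rightarrow> ('x, 'a) gpoly \<Rightarrow> ('x, 'a) gpoly" where
  "der deg t p = (\<Sum>M\<in>Poly_Mapping.keys p. \<Sum>z\<in>#M.
     gmult deg (t z) (gmono (M - {#z#}) (mono_coeff deg {#z#} (M - {#z#}) * cf p M)))"

lemma der_zero [simp]: "der deg t 0 = 0"
  by (simp add: der_def)

text \<open>In the summand of \<open>z\<close> this variable is moved to the front, which costs the
  sign \<open>mono_coeff\<close>. Running over the multiset repeats an even variable as often as its
  exponent, which gives the factor in the power rule.\<close>

lemma der_gmono:
  "der deg t (gmono M r) = (\<Sum>z\<in>#M.
     gmult deg (t z) (gmono (M - {#z#}) (mono_coeff deg {#z#} (M - {#z#}) * r)))"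
  by (simp add: der_def)

lemma der_add: "der deg t (p + q) = der deg t p + der deg t q"
  unfolding der_def
  by (rule setsum_keys_plus_distrib)
     (simp_all add: distrib_left single_add gmult_add_right sum_mset.distrib)

lemma gsmult_sum_mset: "gsmult r (\<Sum>z\<in>#M. f z) = (\<Sum>z\<in>#M. gsmult r (f z))"
  by (induction M) (simp_all add: gsmult_add)

lemma der_gsmult: "der deg t (gsmult r p) = gsmult r (der deg t p)"
proof (induction p rule: gpoly_induct)
  case (mono M c)
  show ?case
    by (simp add: der_gmono gsmult_sum_mset mult_ac flip: gmult_gsmult_right)
qed (simp_all add: der_add gsmult_add)

lemma der_cong:
  assumes "\<And>M z. M \<in> Poly_Mapping.keys p \<Longrightarrow> z \<in># M \<Longrightarrow> t z = t' z"
  shows "der deg t p = der deg t' p"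
  unfolding der_def using assms by (auto intro!: sum.cong arg_cong[where f = sum_mset] image_mset_cong)

lemma mdeg_ge: "z \<in># M \<Longrightarrow> deg z \<le> mdeg deg M"
  by (metis insert_DiffM le_add1 mdeg_add_mset)

lemma der_gpart:
  assumes t: "\<And>z. z \<in> X \<Longrightarrow> t z \<in> gpart X deg (deg z - 1)" "\<And>z. z \<in> X \<Longrightarrow> 1 \<le> deg z"
    and p: "p \<in> gpart X deg (Suc n)"
  shows "der deg t p \<in> gpart X deg n"
  unfolding der_def
proof (intro gpart_sum gpart_sum_mset)
  fix M z assume M: "M \<in> Poly_Mapping.keys p" "z \<in># M"
  with p have *: "M \<in> monomials X deg" "mdeg deg M = Suc n" by (auto simp: gpart_iff)
  with M have "z \<in> X" by (auto simp: monomials_def)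
  have "mdeg deg M = deg z + mdeg deg (M - {#z#})"
    using M by (metis insert_DiffM mdeg_add_mset)
  \<comment> \<open>Since \<open>deg z\<close> is positive, the truncated subtraction
    \<open>deg z - 1\<close> loses nothing.\<close>
  with * t(2)[OF \<open>z \<in> X\<close>] have n: "n = (deg z - 1) + mdeg deg (M - {#z#})" by simp
  show "gmult deg (t z) (gmono (M - {#z#}) (mono_coeff deg {#z#} (M - {#z#}) * cf p M)) \<in> gpart X deg n"
    unfolding n using monomials_subset[OF *(1), of "M - {#z#}"] t(1)[OF \<open>z \<in> X\<close>]
    by (intro gmult_gpart gpart_gmono) auto
qed

text \<open>Associativity for \<open>z\<close>, \<open>M\<close>, \<open>N\<close> relates the four
  signs; as signs square to 1, it can be solved for the factor that appears when the derivation hits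
  the left monomial.\<close>

lemma mono_coeff_Leibniz_left:
  assumes "add_mset z M + N \<in> monomials UNIV deg"
  shows "mono_coeff deg M N * mono_coeff deg {#z#} M =
    (mono_coeff deg {#z#} (M + N) * mono_coeff deg (add_mset z M) N :: 'a::comm_ring_1)"
proof -
  let ?A = "mono_coeff deg {#z#} M :: 'a" and ?B = "mono_coeff deg (add_mset z M) N :: 'a"
    and ?C = "mono_coeff deg M N :: 'a" and ?D = "mono_coeff deg {#z#} (M + N) :: 'a"
  have AB: "?A * ?B = ?C * ?D"
    using mono_coeff_assoc[of deg "{#z#}" M N] by simp
  have A: "?A * ?A = 1" and D: "?D * ?D = 1"
    using assms by (auto intro!: mono_coeff_square monomials_subset[OF assms])
  have "?C * ?A = (?D * ?D) * (?C * ?A)" using D by simp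
  also have "\<dots> = ?A * (?C * ?D) * ?D" by (simp only: mult_ac)
  also have "\<dots> = (?A * ?A) * ?B * ?D" by (simp only: AB[symmetric] mult_ac)
  finally show ?thesis using A by (simp add: mult_ac)
qed

text \<open>Here the derivation passes \<open>M\<close> before reaching \<open>z\<close>.
  Associativity for \<open>M\<close>, \<open>z\<close>, \<open>N\<close> is compared with
  associativity for \<open>z\<close>, \<open>M\<close>, \<open>N\<close>, and exchanging
  \<open>M\<close> and \<open>z\<close> produces the extra sign.\<close>

lemma mono_coeff_Leibniz_right:
  assumes "M + add_mset z N \<in> monomials UNIV deg"
  shows "(-1) ^ (mdeg deg M * deg z) * mono_coeff deg M N * mono_coeff deg {#z#} N =
    (mono_coeff deg {#z#} (M + N) * mono_coeff deg M (add_mset z N) :: 'a::comm_ring_1)"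
proof -
  let ?s = "(-1) ^ (mdeg deg M * deg z) :: 'a"
    and ?a = "mono_coeff deg {#z#} M :: 'a" and ?b = "mono_coeff deg (add_mset z M) N :: 'a"
    and ?c = "mono_coeff deg {#z#} N :: 'a" and ?e = "mono_coeff deg M (add_mset z N) :: 'a"
    and ?f = "mono_coeff deg M N :: 'a" and ?g = "mono_coeff deg {#z#} (M + N) :: 'a"
  have "?s * ?a * ?b = ?c * ?e"
    using mono_coeff_assoc[of deg M "{#z#}" N, where 'a = 'a] mono_coeff_commute[of deg M "{#z#}", where 'a = 'a]
    by simp
  moreover have "?a * ?b = ?f * ?g"
    using mono_coeff_assoc[of deg "{#z#}" M N] by simp
  ultimately have ce: "?c * ?e = ?s * (?f * ?g)" by (simp add: mult.assoc)
  have c: "?c * ?c = 1" and g: "?g * ?g = 1"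
    using assms by (auto intro!: mono_coeff_square monomials_subset[OF assms])
  have "?g * ?e = (?c * ?c) * (?g * ?e)" using c by simp
  also have "\<dots> = ?g * ?c * (?c * ?e)" by (simp only: mult_ac)
  also have "\<dots> = ?s * ?f * ?c * (?g * ?g)" by (subst ce) (simp only: mult_ac)
  finally show ?thesis using g by simp
qed

text \<open>For odd \<open>z\<close> the product of the monomials \<open>zM\<close> and
  \<open>zN\<close> is 0, so the two Leibniz terms that differentiate \<open>z\<close> have to
  cancel. Their signs are opposite because the exponent \<open>(|z| + |M|)|z|\<close> differs from
  \<open>|M||z|\<close> by the odd number \<open>|z||z|\<close>.\<close>

lemma mono_coeff_Leibniz_cancel:
  assumes "odd (deg z)" "add_mset z M \<in> monomials UNIV deg" "add_mset z N \<in> monomials UNIV deg"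
  shows "mono_coeff deg M (add_mset z N) * mono_coeff deg {#z#} M +
    (-1) ^ (mdeg deg (add_mset z M) * deg z) * mono_coeff deg (add_mset z M) N *
      mono_coeff deg {#z#} N = (0 :: 'a::comm_ring_1)"
proof (cases "M + add_mset z N \<in> monomials UNIV deg")
  case True
  have z: "z \<notin># M"
    using assms(1) monomials_add_even[of "{#z#}" M UNIV deg z] assms(2) by auto
  have MN: "M + N \<in> monomials UNIV deg" using monomials_subset[OF True] by simp
  have "sort_sign deg M {#z#} * sort_sign deg {#z#} M = ((-1) ^ (mdeg deg M * deg z) :: 'a)"
    using sort_sign_commute[of M "{#z#}" deg] z by simp
  then have "sort_sign deg M (add_mset z N) * sort_sign deg {#z#} M =
      ((-1) ^ (mdeg deg M * deg z) * sort_sign deg M N :: 'a)"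
    unfolding sort_sign_add_mset_right[of deg M z N] by (metis (no_types, lifting) mult.assoc mult.commute)
  moreover have "sort_sign deg (add_mset z M) N * sort_sign deg {#z#} N = (sort_sign deg M N :: 'a)"
    unfolding sort_sign_add_mset_left[of deg z M]
    by (metis (no_types, lifting) mult.assoc mult.commute mult.right_neutral sort_sign_square)
  moreover have "(-1) ^ (mdeg deg (add_mset z M) * deg z) = (- ((-1) ^ (mdeg deg M * deg z)) :: 'a)"
    using assms(1) by (simp add: distrib_right power_add power_mult)
  ultimately show ?thesis
    using True assms(2,3) by (simp add: mono_coeff_def mult.assoc)
qed (simp add: mono_coeff_def)

lemma gmult_gmono_skip:
  assumes "s \<in> gpart X deg i" "N \<in> monomials X deg"
  shows "gmult deg (gmono N r) (gmult deg s (gmono P c)) =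
    gsmult ((-1) ^ (mdeg deg N * i)) (gmult deg s (gmono (N + P) (mono_coeff deg N P * r * c)))"
proof -
  have "gmult deg (gmono N r) (gmult deg s (gmono P c)) = gmult deg (gmult deg (gmono N r) s) (gmono P c)"
    by (simp add: gmult_assoc)
  also have "gmult deg (gmono N r) s = gsmult ((-1) ^ (mdeg deg N * i)) (gmult deg s (gmono N r))"
    using assms by (intro gmult_commute[of _ X _ _ _ X]) (auto intro: gpart_gmono)
  finally show ?thesis by (simp add: gmult_gsmult_left gmult_assoc gmult_mono)
qed

lemma sum_mset_single_nonzero:
  assumes "\<And>z. z \<in># M \<Longrightarrow> f z = (0 :: 'b::comm_monoid_add)"
  shows "(\<Sum>z\<in>#add_mset x M. f z) = f x"
  using assms by (induction M) auto

lemma not_monomials_commonE: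
  assumes "M \<in> monomials X deg" "N \<in> monomials X deg" "M + N \<notin> monomials UNIV deg"
  obtains x where "odd (deg x)" "x \<in># M" "x \<in># N"
proof -
  from assms(3) obtain x where x: "odd (deg x)" "count M x + count N x \<ge> 2"
    by (auto simp: monomials_def not_le Suc_le_eq)
  with assms(1,2) have "count M x \<le> 1" "count N x \<le> 1" by (auto simp: monomials_def)
  with x(2) have "count M x > 0" "count N x > 0" by linarith+
  with x(1) that show thesis by (auto simp: count_greater_zero_iff)
qed

text \<open>Let \<open>f\<close>, \<open>g\<close>, \<open>h\<close> be the summands of the three
  terms of the Leibniz rule, indexed by the differentiated variable. If \<open>M + N\<close> is a
  monomial, they agree one by one. Otherwise there is a common odd variable; all summands vanish
  except possibly the two that differentiate it, and these cancel.\<close>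

lemma der_gmult_gmono:
  fixes t :: "'x::linorder \<Rightarrow> ('x, 'a::comm_ring_1) gpoly"
  assumes t: "\<And>z. z \<in> X \<Longrightarrow> t z \<in> gpart X deg (deg z - 1)" "\<And>z. z \<in> X \<Longrightarrow> 1 \<le> deg z"
    and M: "M \<in> monomials X deg" and N: "N \<in> monomials X deg"
  shows "der deg t (gmult deg (gmono M r) (gmono N s)) =
     gmult deg (der deg t (gmono M r)) (gmono N s) +
     gsmult ((-1) ^ mdeg deg M) (gmult deg (gmono M r) (der deg t (gmono N s)))"
proof -
  define f where "f z = gmult deg (t z) (gmono (M + N - {#z#})
      (mono_coeff deg {#z#} (M + N - {#z#}) * (mono_coeff deg M N * r * s)))" for z
  define g where "g z = gmult deg (t z) (gmono (M - {#z#} + N)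
      (mono_coeff deg (M - {#z#}) N * (mono_coeff deg {#z#} (M - {#z#}) * r) * s))" for z
  define h where "h z = gmult deg (t z) (gmono (M + (N - {#z#}))
      ((-1) ^ (mdeg deg M * deg z) * mono_coeff deg M (N - {#z#}) *
       mono_coeff deg {#z#} (N - {#z#}) * r * s))" for z
  have lhs: "der deg t (gmult deg (gmono M r) (gmono N s)) = (\<Sum>z\<in>#M. f z) + (\<Sum>z\<in>#N. f z)"
    by (simp add: gmult_mono der_gmono f_def)
  have rhs1: "gmult deg (der deg t (gmono M r)) (gmono N s) = (\<Sum>z\<in>#M. g z)"
    by (simp add: der_gmono gmult_sum_mset_left gmult_assoc gmult_mono g_def)
  have rhs2: "gsmult ((-1) ^ mdeg deg M) (gmult deg (gmono M r) (der deg t (gmono N s))) = (\<Sum>z\<in>#N. h z)"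
    unfolding der_gmono gmult_sum_mset_right gsmult_sum_mset
  proof (rule arg_cong[where f = sum_mset], rule image_mset_cong)
    fix z assume "z \<in># N"
    with N have z: "z \<in> X" by (auto simp: monomials_def)
    \<comment> \<open>The rule contributes the exponent \<open>|M|\<close>, and passing
      \<open>t z\<close>, of degree \<open>|z| - 1\<close>, contributes \<open>|M|(|z| - 1)\<close>;
      together they give the exponent \<open>|M||z|\<close> in \<open>h\<close>.\<close>
    have "mdeg deg M + mdeg deg M * (deg z - 1) = mdeg deg M * deg z"
      using t(2)[OF z] by (cases "deg z") simp_all
    then have "(-1) ^ mdeg deg M * (-1) ^ (mdeg deg M * (deg z - 1)) = ((-1) ^ (mdeg deg M * deg z) :: 'a)"
      by (simp flip: power_add)
    then show "gsmult ((-1) ^ mdeg deg M) (gmult deg (gmono M r) (gmult deg (t z)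
        (gmono (N - {#z#}) (mono_coeff deg {#z#} (N - {#z#}) * s)))) = h z"
      unfolding gmult_gmono_skip[OF t(1)[OF z] M] h_def gsmult_gsmult
      by (simp add: mult.assoc flip: gmult_gsmult_right) (simp only: mult_ac)
  qed
  show ?thesis
  proof (cases "M + N \<in> monomials UNIV deg")
    case True
    have "g z = f z" if "z \<in># M" for z
    proof -
      from that obtain M' where M': "M = add_mset z M'" by (metis insert_DiffM)
      show ?thesis
        using mono_coeff_Leibniz_left[of z M' N deg, where 'a = 'a] True
        by (simp add: f_def g_def M' flip: mult.assoc)
    qed
    moreover have "h z = f z" if "z \<in># N" for z
    proof -
      from that obtain N' where N': "N = add_mset z N'" by (metis insert_DiffM)
      show ?thesis
        using mono_coeff_Leibniz_right[of M z N' deg, where 'a = 'a] True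
        by (simp add: f_def h_def N' flip: mult.assoc)
    qed
    ultimately show ?thesis
      unfolding lhs rhs1 rhs2 by (simp cong: image_mset_cong)
  next
    case False
    obtain x where x: "odd (deg x)" "x \<in># M" "x \<in># N"
      using not_monomials_commonE[OF M N False] .
    then obtain M' N' where MN': "M = add_mset x M'" "N = add_mset x N'" by (metis insert_DiffM)
    have xM: "x \<notin># M'" using monomials_add_even[of "{#x#}" M' X deg x] M x(1) MN' by auto
    have xN: "x \<notin># N'" using monomials_add_even[of "{#x#}" N' X deg x] N x(1) MN' by auto
    have f0: "f z = 0" for z using False by (simp add: f_def mono_coeff_def)
    then have "(\<Sum>z\<in>#P. f z) = 0" for P by (induction P) simp_all
    from this[of M] this[of N] have "(\<Sum>z\<in>#M. f z) + (\<Sum>z\<in>#N. f z) = 0" by simp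
    moreover have "g z = 0" if "z \<in># M'" for z
    proof -
      \<comment> \<open>Removing a variable other than \<open>x\<close> leaves both copies of
        \<open>x\<close>, so the product is still 0.\<close>
      have "M - {#z#} + N \<notin> monomials UNIV deg"
        using that xM x monomials_add_even[of "M - {#z#}" N UNIV deg x]
        by (auto simp: MN' in_diff_count)
      then show ?thesis by (simp add: g_def mono_coeff_def)
    qed
    moreover have "h z = 0" if "z \<in># N'" for z
    proof -
      have "M + (N - {#z#}) \<notin> monomials UNIV deg"
        using that xN x monomials_add_even[of M "N - {#z#}" UNIV deg x]
        by (auto simp: MN' in_diff_count)
      then show ?thesis by (simp add: h_def mono_coeff_def)
    qed
    moreover have "g x + h x = 0"
    proof -
      have "g x + h x = gmult deg (t x) (gmono (add_mset x (M' + N'))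
          ((mono_coeff deg M' (add_mset x N') * mono_coeff deg {#x#} M' +
            (-1) ^ (mdeg deg (add_mset x M') * deg x) * mono_coeff deg (add_mset x M') N' *
            mono_coeff deg {#x#} N') * r * s))"
        by (simp add: g_def h_def MN' single_add distrib_right flip: gmult_add_right mult.assoc)
      then show ?thesis
        using mono_coeff_Leibniz_cancel[of deg x M' N', where 'a = 'a] x M N MN' monomials_UNIV
        by (metis (no_types, lifting) gmult_zero(2) mult_zero_left single_zero)
    qed
    ultimately show ?thesis
      unfolding lhs rhs1 rhs2
      using sum_mset_single_nonzero[of M' g x, folded MN'] sum_mset_single_nonzero[of N' h x, folded MN']
      by simp
  qed
qed

lemma der_gmult:
  assumes t: "\<And>z. z \<in> X \<Longrightarrow> t z \<in> gpart X deg (deg z - 1)" "\<And>z. z \<in> X \<Longrightarrow> 1 \<le> deg z"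
    and p: "p \<in> gpart X deg i" and q: "q \<in> galg X deg"
  shows "der deg t (gmult deg p q) =
     gmult deg (der deg t p) q + gsmult ((-1) ^ i) (gmult deg p (der deg t q))"
proof (induction p rule: gpoly_induct)
  case M: (mono M c)
  show ?case
  proof (induction q rule: gpoly_induct)
    case N: (mono N c')
    show ?case
      using der_gmult_gmono[of X t deg M N c c'] t M N p q by (auto simp: gpart_iff galg_def)
  qed (simp_all add: gmult_add_right der_add gsmult_add)
qed (simp_all add: gmult_add_left der_add gsmult_add)


section \<open>Ideals\<close>

lemma module_times: "module ((*) :: 'a::comm_ring_1 \<Rightarrow> 'a \<Rightarrow> 'a)"
  by unfold_locales (simp_all add: algebra_simps)

lemma ideal_iff:
  "ideal I \<longleftrightarrow> 0 \<in> I \<and> (\<forall>x\<in>I. \<forall>y\<in>I. x + y \<in> I) \<and> (\<forall>r. \<forall>x\<in>I. r * x \<in> I)"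
  by (simp add: module.subspace_def[OF module_times])

lemma ideal_zero: "ideal I \<Longrightarrow> 0 \<in> I"
  and ideal_add: "ideal I \<Longrightarrow> x \<in> I \<Longrightarrow> y \<in> I \<Longrightarrow> x + y \<in> I"
  and ideal_mult_left: "ideal I \<Longrightarrow> x \<in> I \<Longrightarrow> r * x \<in> I"
  and ideal_mult_right: "ideal I \<Longrightarrow> x \<in> I \<Longrightarrow> x * r \<in> I"
  by (auto simp: ideal_iff mult.commute)

lemma ideal_sum: "ideal I \<Longrightarrow> (\<And>i. i \<in> A \<Longrightarrow> f i \<in> I) \<Longrightarrow> (\<Sum>i\<in>A. f i) \<in> I"
  by (induction A rule: infinite_finite_induct) (auto intro: ideal_zero ideal_add)

lemma ideal_sum_mset: "ideal I \<Longrightarrow> (\<And>i. i \<in># A \<Longrightarrow> f i \<in> I) \<Longrightarrow> (\<Sum>i\<in>#A. f i) \<in> I"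
  by (induction A) (auto intro: ideal_zero ideal_add)

lemma ideal_UNIV_iff: "ideal I \<Longrightarrow> I = UNIV \<longleftrightarrow> 1 \<in> I"
  using ideal_mult_left[of I 1] by auto

text \<open>Zorn's lemma, with properness expressed as \<open>1 \<notin> J\<close> because this
  passes to unions of chains.\<close>

lemma proper_ideal_subset_maximal:
  fixes I :: "'a::comm_ring_1 set"
  assumes "ideal I" "I \<noteq> UNIV"
  obtains M where "maximal_ideal M" "I \<subseteq> M"
proof -
  let ?A = "{J. ideal J \<and> I \<subseteq> J \<and> 1 \<notin> J}"
  have "\<exists>M\<in>?A. \<forall>J\<in>?A. M \<subseteq> J \<longrightarrow> J = M"
  proof (rule subset_Zorn_nonempty)
    show "?A \<noteq> {}" using assms ideal_UNIV_iff by blast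
  next
    fix C assume C: "C \<noteq> {}" "subset.chain ?A C"
    then have ideals: "ideal J" "I \<subseteq> J" "1 \<notin> J" if "J \<in> C" for J
      using that by (auto simp: subset.chain_def)
    have "ideal (\<Union>C)"
      unfolding ideal_iff
    proof (intro conjI ballI allI)
      show "0 \<in> \<Union>C" using C(1) ideals(1) ideal_zero by blast
    next
      fix x y assume "x \<in> \<Union>C" "y \<in> \<Union>C"
      then obtain J J' where J: "x \<in> J" "J \<in> C" "y \<in> J'" "J' \<in> C" by blast
      with C(2) have "J \<subseteq> J' \<or> J' \<subseteq> J" by (auto simp: subset.chain_def)
      with J ideals(1) show "x + y \<in> \<Union>C" by (blast intro: ideal_add)
    next
      fix r x assume "x \<in> \<Union>C"
      with ideals(1) show "r * x \<in> \<Union>C" by (blast intro: ideal_mult_left)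
    qed
    with C(1) ideals show "\<Union>C \<in> ?A" by blast
  qed
  then obtain M where M: "M \<in> ?A" and max: "\<forall>J\<in>?A. M \<subseteq> J \<longrightarrow> J = M"
    by (rule bexE)
  have "J = M \<or> J = UNIV" if "ideal J" "M \<subseteq> J" for J
  proof (cases "1 \<in> J")
    case True
    with that(1) ideal_UNIV_iff show ?thesis by blast
  next
    case False
    with that M have "J \<in> ?A" by auto
    with that(2) max show ?thesis by auto
  qed
  with M have "maximal_ideal M" by (auto simp: maximal_ideal_def)
  moreover from M have "I \<subseteq> M" by simp
  ultimately show thesis by (rule that)
qed

lemma proper_ideal_subset_local:
  assumes "noetherian_local_ring \<mm>" "ideal I" "I \<noteq> UNIV"
  shows "I \<subseteq> \<mm>"
proof -
  obtain M where "maximal_ideal M" "I \<subseteq> M"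
    using proper_ideal_subset_maximal[OF assms(2,3)] .
  then show ?thesis using assms(1) by (auto simp: noetherian_local_ring_def)
qed


section \<open>Polynomials with vanishing linear part\<close>

lemma empty_in_monomials [simp]: "{#} \<in> monomials X deg"
  and single_in_monomials [simp]: "{#x#} \<in> monomials X deg \<longleftrightarrow> x \<in> X"
  by (auto simp: monomials_def)

lemma cf_gmult_empty: "cf (gmult deg p q) {#} = cf p {#} * cf q {#}"
proof (induction p rule: gpoly_induct)
  case (mono M c)
  show ?case
    by (induction q rule: gpoly_induct)
       (auto simp: gmult_mono gmult_add_right lookup_add lookup_single when_def mono_coeff_def distrib_left)
qed (simp_all add: gmult_add_left lookup_add distrib_right)

text \<open>The multiset \<open>{#x#}\<close> is a sum of two multisets only if one of them is
  empty, and then the sign is 1.\<close>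

lemma cf_gmult_single:
  "cf (gmult deg p q) {#x#} = cf p {#} * cf q {#x#} + cf p {#x#} * cf q {#}"
proof (induction p rule: gpoly_induct)
  case (mono M c)
  show ?case
  proof (induction q rule: gpoly_induct)
    case (mono N c')
    show ?case
      by (auto simp: gmult_mono lookup_single when_def mono_coeff_def union_is_single single_is_union)
  qed (simp_all add: gmult_add_right lookup_add algebra_simps)
qed (simp_all add: gmult_add_left lookup_add algebra_simps)

text \<open>Within \<open>R[X]\<close> this is the ideal \<open>J R[X] + (X)^2\<close>. Controlling
  the constant coefficient as well is what makes it stable under multiplication by arbitrary
  polynomials.\<close>

definition linear_part_in :: "'a::comm_ring_1 set \<Rightarrow> ('x, 'a) gpoly set" where
  "linear_part_in J = {p. cf p {#} \<in> J \<and> (\<forall>x. cf p {#x#} \<in> J)}"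

context
  fixes J :: "'a::comm_ring_1 set"
  assumes J: "ideal J"
begin

lemma linear_part_in_zero: "0 \<in> linear_part_in J"
  using J by (simp add: linear_part_in_def ideal_zero)

lemma linear_part_in_add:
  "p \<in> linear_part_in J \<Longrightarrow> q \<in> linear_part_in J \<Longrightarrow> p + q \<in> linear_part_in J"
  using J by (simp add: linear_part_in_def lookup_add ideal_add)

lemma linear_part_in_gsmult: "p \<in> linear_part_in J \<Longrightarrow> gsmult r p \<in> linear_part_in J"
  using J by (simp add: linear_part_in_def ideal_mult_left)

lemma linear_part_in_gmult:
  "p \<in> linear_part_in J \<or> q \<in> linear_part_in J \<Longrightarrow> gmult deg p q \<in> linear_part_in J"
  by (elim disjE)
     (simp_all add: linear_part_in_def cf_gmult_empty cf_gmult_single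
        ideal_add[OF J] ideal_mult_left[OF J] ideal_mult_right[OF J])

lemma gideal_const_in:
  assumes "\<And>g. g \<in> G \<Longrightarrow> cf g {#} \<in> J" "p \<in> gideal X deg G"
  shows "cf p {#} \<in> J"
  using assms(2)
  by (induction rule: gideal.induct)
     (simp_all add: assms(1) lookup_add cf_gmult_empty ideal_zero[OF J]
        ideal_add[OF J] ideal_mult_left[OF J] ideal_mult_right[OF J])

text \<open>In a product of two elements with constant coefficient in \<open>J\<close>, each linear
  coefficient is a sum of two terms containing one of these constants. This turns the minimality
  condition on the differential into information on linear parts.\<close>

lemma gideal_square_linear_part_in:
  assumes "\<And>p. p \<in> H \<Longrightarrow> cf p {#} \<in> J" "p \<in> gideal_square X deg H"
  shows "p \<in> linear_part_in J"
  using assms(2) unfolding gideal_square_def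
proof (induction rule: gideal.induct)
  case (gen g)
  then obtain p q where "g = gmult deg p q" "p \<in> H" "q \<in> H" by blast
  with assms(1) show ?case
    by (simp add: linear_part_in_def cf_gmult_empty cf_gmult_single
        ideal_add[OF J] ideal_mult_left[OF J] ideal_mult_right[OF J])
qed (auto intro: linear_part_in_zero linear_part_in_add linear_part_in_gmult)

end


section \<open>Differentials\<close>

lemma gvar_gpart: "x \<in> X \<Longrightarrow> gvar x \<in> gpart X deg (deg x)"
  unfolding gvar_def by (rule gpart_gmono) simp

lemma gconst_gpart: "gconst r \<in> gpart X deg 0"
  unfolding gconst_def by (rule gpart_gmono) simp

lemma gmult_gconst_one:
  assumes "p \<in> galg X deg"
  shows "gmult deg p (gconst 1) = p"
proof (induction p rule: gpoly_induct)
  case (mono M r)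
  with assms have "M \<in> monomials UNIV deg"
    by (auto simp: galg_def intro: monomials_UNIV)
  then show ?case by (simp add: gconst_def gmult_mono mono_coeff_def del: single_one)
qed (simp_all add: gmult_add_left)

text \<open>Monomials are built by multiplying variables on the left, so that the Leibniz rule,
  whose left factor has to be homogeneous, applies in the case \<open>var\<close>.\<close>

lemma galg_induct [consumes 1, case_names zero add const var]:
  fixes p :: "('x::linorder, 'a::comm_ring_1) gpoly"
  assumes "p \<in> galg X deg"
    and "P 0"
    and "\<And>p q. p \<in> galg X deg \<Longrightarrow> q \<in> galg X deg \<Longrightarrow> P p \<Longrightarrow> P q \<Longrightarrow> P (p + q)"
    and "\<And>r. P (gconst r)"
    and "\<And>x q. x \<in> X \<Longrightarrow> q \<in> galg X deg \<Longrightarrow> P q \<Longrightarrow> P (gmult deg (gvar x) q)"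
  shows "P p"
proof -
  have monom: "P (gmono M r)" if "M \<in> monomials X deg" for M r
    using that
  proof (induction M arbitrary: r)
    case empty
    then show ?case using assms(4) by (simp add: gconst_def)
  next
    case (add x M)
    have M: "M \<in> monomials X deg" and x: "x \<in> X"
      using add.prems monomials_subset[OF add.prems, of M] by (auto simp: monomials_def)
    \<comment> \<open>The extra factor \<open>mono_coeff deg {#x#} M\<close> cancels the sign of the
      multiplication, since it squares to 1.\<close>
    have "gmono (add_mset x M) r = gmult deg (gvar x) (gmono M (mono_coeff deg {#x#} M * r))"
      using mono_coeff_square[of "{#x#}" M deg, where 'a = 'a] monomials_UNIV[OF add.prems]
      by (simp add: gvar_def gmult_mono flip: mult.assoc)
    then show ?case using assms(5)[OF x _ add.IH[OF M]] M by (simp add: galg_gmono)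
  qed
  have "p \<in> galg X deg \<and> P p"
  proof (induction p rule: gpoly_induct)
    case (mono M r)
    with assms(1) have "M \<in> monomials X deg" by (auto simp: galg_def)
    with monom show ?case by (simp add: galg_gmono)
  qed (simp_all add: assms(2,3) galg_add)
  then show ?thesis by blast
qed

lemma gmult_uminus_left: "gmult deg (- p) q = - gmult deg p q"
  using gmult_gsmult_left[of deg "-1" p q] by simp

lemma gmult_uminus_right: "gmult deg p (- q) = - gmult deg p q"
  using gmult_gsmult_right[of deg p "-1" q] by simp


section \<open>The differential on \<open>R[X]\<close>\<close>

locale dg_polynomials =
  fixes X :: "'x::linorder set" and deg :: "'x \<Rightarrow> nat"
    and d :: "('x, 'a::comm_ring_1) gpoly \<Rightarrow> ('x, 'a) gpoly"
  assumes d: "dg_differential X deg d" and deg_pos: "\<And>x. x \<in> X \<Longrightarrow> 1 \<le> deg x"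
begin

lemma d_add: "p \<in> galg X deg \<Longrightarrow> q \<in> galg X deg \<Longrightarrow> d (p + q) = d p + d q"
  and d_gsmult: "p \<in> galg X deg \<Longrightarrow> d (gsmult r p) = gsmult r (d p)"
  and d_gpart: "p \<in> gpart X deg (Suc i) \<Longrightarrow> d p \<in> gpart X deg i"
  and d_gpart_0: "p \<in> gpart X deg 0 \<Longrightarrow> d p = 0"
  and d_d: "p \<in> galg X deg \<Longrightarrow> d (d p) = 0"
  and d_gmult: "p \<in> gpart X deg i \<Longrightarrow> q \<in> galg X deg \<Longrightarrow>
        d (gmult deg p q) = gmult deg (d p) q + gsmult ((-1) ^ i) (gmult deg p (d q))"
proof -
  note d' = d[unfolded dg_differential_def]
  show "p \<in> galg X deg \<Longrightarrow> q \<in> galg X deg \<Longrightarrow> d (p + q) = d p + d q"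
    using d'[THEN conjunct1] by simp
  show "p \<in> galg X deg \<Longrightarrow> d (gsmult r p) = gsmult r (d p)"
    using d'[THEN conjunct2, THEN conjunct1] by simp
  show "p \<in> gpart X deg (Suc i) \<Longrightarrow> d p \<in> gpart X deg i"
    using d'[THEN conjunct2, THEN conjunct2, THEN conjunct1] by simp
  show "p \<in> gpart X deg 0 \<Longrightarrow> d p = 0"
    using d'[THEN conjunct2, THEN conjunct2, THEN conjunct2, THEN conjunct1] by simp
  show "p \<in> galg X deg \<Longrightarrow> d (d p) = 0"
    using d'[THEN conjunct2, THEN conjunct2, THEN conjunct2, THEN conjunct2, THEN conjunct1] by simp
  show "p \<in> gpart X deg i \<Longrightarrow> q \<in> galg X deg \<Longrightarrow>
      d (gmult deg p q) = gmult deg (d p) q + gsmult ((-1) ^ i) (gmult deg p (d q))"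
    using d'[THEN conjunct2, THEN conjunct2, THEN conjunct2, THEN conjunct2, THEN conjunct2] by simp
qed

lemma d_zero: "d 0 = 0"
  using d_gpart_0[of 0] by simp

lemma d_gconst: "d (gconst r) = 0"
  by (rule d_gpart_0[OF gconst_gpart])

lemma d_sum:
  assumes "\<And>i. i \<in> A \<Longrightarrow> f i \<in> galg X deg"
  shows "d (\<Sum>i\<in>A. f i) = (\<Sum>i\<in>A. d (f i))"
  using assms
proof (induction A rule: infinite_finite_induct)
  case (insert i A)
  then have "f i \<in> galg X deg" "(\<Sum>i\<in>A. f i) \<in> galg X deg"
    by (blast intro: galg_sum)+
  with insert show ?case by (simp add: d_add)
qed (simp_all add: d_zero)

lemma gvar_galg: "x \<in> X \<Longrightarrow> (gvar x :: ('x, 'a) gpoly) \<in> galg X deg"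
  by (rule gpart_galg[OF gvar_gpart])

lemma d_gvar: "x \<in> X \<Longrightarrow> d (gvar x) \<in> gpart X deg (deg x - 1)"
  using deg_pos[of x] gvar_gpart[of x X deg] d_gpart[of "gvar x" "deg x - 1"] by simp

lemma d_galg: "p \<in> galg X deg \<Longrightarrow> d p \<in> galg X deg"
proof (induction rule: galg_induct)
  case (var x q)
  then have "d (gvar x) \<in> galg X deg" "(gvar x :: ('x, 'a) gpoly) \<in> galg X deg"
    using gpart_galg[OF d_gvar] gvar_galg by simp_all
  with var show ?case
    by (simp add: d_gmult[OF gvar_gpart] gmult_galg galg_add galg_gsmult)
qed (auto simp: d_zero d_add d_gconst)

text \<open>Constants are killed and \<open>linear_part_in J\<close> is an ideal, so by the Leibniz
  rule only the values on the variables matter.\<close>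

lemma d_linear_part_in:
  assumes J: "ideal J" and gvar: "\<And>x. x \<in> X \<Longrightarrow> d (gvar x) \<in> linear_part_in J"
    and p: "p \<in> galg X deg"
  shows "d p \<in> linear_part_in J"
  using p
proof (induction rule: galg_induct)
  case (var x q)
  have "gmult deg (d (gvar x)) q \<in> linear_part_in J" "gmult deg (gvar x) (d q) \<in> linear_part_in J"
    by (rule linear_part_in_gmult[OF J], simp add: gvar[OF var(1)] var(3))+
  then show ?case
    using d_gmult[OF gvar_gpart[OF var(1)] var(2)]
    by (simp add: linear_part_in_add[OF J] linear_part_in_gsmult[OF J])
qed (simp_all add: d_zero d_add d_gconst linear_part_in_zero[OF J] linear_part_in_add[OF J])

end

section \<open>Derivations anticommuting with the differential\<close>

locale dg_derivation = dg_polynomials X deg d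
  for X :: "'x::linorder set" and deg and d :: "('x, 'a::comm_ring_1) gpoly \<Rightarrow> ('x, 'a) gpoly" +
  fixes t :: "'x \<Rightarrow> ('x, 'a) gpoly"
  assumes t: "\<And>z. z \<in> X \<Longrightarrow> t z \<in> gpart X deg (deg z - 1)"
begin

lemma der_gvar_eq: "z \<in> X \<Longrightarrow> der deg t (gvar z) = t z"
  using t[of z] gmult_gconst_one[of "t z" X deg]
  by (simp add: gvar_def der_gmono mono_coeff_def gpart_galg flip: gconst_def)

lemma der_galg:
  assumes "p \<in> galg X deg"
  shows "der deg t p \<in> galg X deg"
  using assms
proof (induction rule: galg_induct)
  case (var x q)
  then have "t x \<in> galg X deg" "(gvar x :: ('x, 'a) gpoly) \<in> galg X deg"
    using gpart_galg[OF t] gvar_galg by simp_all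
  with var show ?case
    by (simp add: der_gmult[OF t deg_pos gvar_gpart] der_gvar_eq gmult_galg galg_add galg_gsmult)
qed (auto simp: der_add gconst_def der_gmono)

text \<open>The sum of the two compositions of the odd derivations \<open>d\<close> and
  \<open>der deg t\<close> is again a derivation, so it vanishes once it vanishes on generators.
  Restricting to \<open>Y\<close> allows its use while suitable values of \<open>t\<close> are known
  only on variables of low degree.\<close>

lemma d_der_anticommute:
  assumes Y: "Y \<subseteq> X" "\<And>y. y \<in> Y \<Longrightarrow> d (t y) = - der deg t (d (gvar y))"
    and p: "p \<in> galg Y deg"
  shows "d (der deg t p) = - der deg t (d p)"
  using p
proof (induction rule: galg_induct)
  case zero
  then show ?case by (simp add: d_zero)
next
  case (add p q)
  have "p \<in> galg X deg" "q \<in> galg X deg"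
    by (rule subsetD[OF galg_subset[OF Y(1)]], fact add)+
  with add show ?case by (simp add: der_add d_add der_galg)
next
  case (const r)
  then show ?case by (simp add: d_gconst) (simp add: gconst_def der_gmono d_zero)
next
  case (var x q)
  have q: "q \<in> galg X deg" by (rule subsetD[OF galg_subset[OF Y(1)] var(2)])
  have x: "x \<in> X" using var(1) Y(1) by blast
  define e where "e = deg x - 1"
  have e: "deg x = Suc e" using deg_pos[OF x] by (simp add: e_def)
  have tx: "t x \<in> gpart X deg e" and dx: "d (gvar x) \<in> gpart X deg e" and gx: "(gvar x :: ('x, 'a) gpoly) \<in> gpart X deg (Suc e)"
    using t[OF x] d_gvar[OF x] gvar_gpart[OF x, of deg] by (simp_all add: e)
  note gpart_galg[OF tx] gpart_galg[OF dx] gpart_galg[OF gx]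
  note galg = this der_galg[OF q] d_galg[OF q] q
  show ?case
  proof -
    \<comment> \<open>\<open>\<sigma>\<close> is the sign of passing an element of degree
      \<open>e\<close>, such as \<open>t x\<close> or \<open>d (gvar x)\<close>; passing
      \<open>gvar x\<close>, of degree \<open>e + 1\<close>, gives
      \<open>- \<sigma>\<close>.\<close>
    define \<sigma> :: 'a where "\<sigma> = (-1) ^ e"
    have \<sigma>: "(-1) ^ Suc e = - \<sigma>" "\<sigma> * \<sigma> = 1"
      by (simp_all add: \<sigma>_def flip: power_mult_distrib)
    have "der deg t (gmult deg (gvar x) q) =
        gmult deg (t x) q + gsmult (- \<sigma>) (gmult deg (gvar x) (der deg t q))"
      by (simp only: der_gmult[OF t deg_pos gx q] der_gvar_eq[OF x] \<sigma>)
    then have "d (der deg t (gmult deg (gvar x) q)) =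
        gmult deg (d (t x)) q + gsmult \<sigma> (gmult deg (t x) (d q)) +
        gsmult (- \<sigma>) (gmult deg (d (gvar x)) (der deg t q) +
          gsmult (- \<sigma>) (gmult deg (gvar x) (d (der deg t q))))"
      using galg
      by (simp only: d_add galg_gsmult gmult_galg d_gsmult d_gmult[OF tx q]
          d_gmult[OF gx der_galg[OF q]] \<sigma> flip: \<sigma>_def)
    also have "\<dots> = - (gmult deg (der deg t (d (gvar x))) q +
          gsmult \<sigma> (gmult deg (d (gvar x)) (der deg t q)) +
        gsmult (- \<sigma>) (gmult deg (t x) (d q) +
          gsmult (- \<sigma>) (gmult deg (gvar x) (der deg t (d q)))))"
      unfolding var.IH Y(2)[OF var(1)] gmult_uminus_left gmult_uminus_right
      by (rule poly_mapping_eqI) (simp add: lookup_add lookup_minus algebra_simps)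
    also have "gmult deg (der deg t (d (gvar x))) q +
          gsmult \<sigma> (gmult deg (d (gvar x)) (der deg t q)) +
        gsmult (- \<sigma>) (gmult deg (t x) (d q) +
          gsmult (- \<sigma>) (gmult deg (gvar x) (der deg t (d q)))) =
        der deg t (d (gmult deg (gvar x) q))"
      by (simp only: d_gmult[OF gx q] der_add der_gsmult der_gmult[OF t deg_pos dx q]
          der_gmult[OF t deg_pos gx d_galg[OF q]] der_gvar_eq[OF x] \<sigma> flip: \<sigma>_def)
    finally show ?thesis .
  qed
qed

end

section \<open>Inductive construction of the derivation\<close>

context dg_polynomials
begin

lemma d_uminus: "p \<in> galg X deg \<Longrightarrow> d (- p) = - d p"
  using d_gsmult[of p "-1"] by simp

lemma mdeg_eq_0_iff: "M \<in> monomials X deg \<Longrightarrow> mdeg deg M = 0 \<longleftrightarrow> M = {#}"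
proof -
  assume M: "M \<in> monomials X deg"
  have "1 \<le> mdeg deg M" if "x \<in># M" for x
    using that M deg_pos[of x] mdeg_ge[OF that, of deg] by (auto simp: monomials_def)
  then show ?thesis by (cases M) fastforce+
qed

lemma gpart_0_eq:
  assumes "p \<in> gpart X deg 0"
  shows "p = gconst (cf p {#})"
proof (rule poly_mapping_eqI)
  fix M
  have "M = {#}" if "M \<in> Poly_Mapping.keys p"
    using that assms mdeg_eq_0_iff by (auto simp: gpart_iff)
  then show "cf p M = cf (gconst (cf p {#})) M"
    by (auto simp: gconst_def lookup_single when_def in_keys_iff simp del: single_one)
qed

lemma gpart_1_eq:
  assumes p: "p \<in> gpart X deg 1" and fin: "finite (vars_in_degree X deg 1)"
  shows "p = (\<Sum>x\<in>vars_in_degree X deg 1. gsmult (cf p {#x#}) (gvar x))"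
proof (rule poly_mapping_eqI)
  fix M
  have sum: "cf (\<Sum>x\<in>vars_in_degree X deg 1. gsmult (cf p {#x#}) (gvar x)) M =
      (\<Sum>x\<in>vars_in_degree X deg 1. if {#x#} = M then cf p M else 0)"
    by (auto simp: lookup_sum gvar_def lookup_single when_def intro!: sum.cong)
  show "cf p M = cf (\<Sum>x\<in>vars_in_degree X deg 1. gsmult (cf p {#x#}) (gvar x)) M"
  proof (cases "M \<in> Poly_Mapping.keys p")
    case True
    with p have M: "M \<in> monomials X deg" "mdeg deg M = 1" by (auto simp: gpart_iff)
    then obtain x N where MN: "M = add_mset x N" by (metis mdeg_empty multiset_cases zero_neq_one)
    then have "x \<in> X" "N \<in> monomials X deg"
      using M monomials_subset[OF M(1), of N] by (auto simp: monomials_def)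
    with MN M deg_pos[of x] have "mdeg deg N = 0" "deg x = 1" by auto
    with \<open>N \<in> monomials X deg\<close> have "M = {#x#}" "x \<in> vars_in_degree X deg 1"
      using mdeg_eq_0_iff MN \<open>x \<in> X\<close> by (auto simp: vars_in_degree_def)
    then show ?thesis unfolding sum using fin by simp
  next
    case False
    then have "cf p M = 0" by (simp add: in_keys_iff)
    then show ?thesis unfolding sum by (simp add: sum.neutral)
  qed
qed

lemma der_gpart_0: "p \<in> gpart X deg 0 \<Longrightarrow> der deg t p = 0"
  by (subst gpart_0_eq) (simp_all add: gconst_def der_gmono del: single_one)

text \<open>The shift by \<open>Suc\<close> makes stage 0 concern the variables of degree 1. On
  variables of degree above \<open>Suc n\<close> the values of \<open>t\<close> are provisional:
  only their degree is prescribed.\<close>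

definition lifts_upto :: "'x \<Rightarrow> nat \<Rightarrow> ('x \<Rightarrow> ('x, 'a) gpoly) \<Rightarrow> bool" where
  "lifts_upto x\<^sub>1 n t \<longleftrightarrow>
     (\<forall>z\<in>X. t z \<in> gpart X deg (deg z - 1)) \<and>
     (\<forall>z\<in>vars_in_degree X deg 1. t z = (if z = x\<^sub>1 then gconst 1 else 0)) \<and>
     (\<forall>y\<in>X. deg y \<le> Suc n \<longrightarrow> d (t y) = - der deg t (d (gvar y)))"

text \<open>Stage \<open>n + 1\<close> chooses new values on the variables of degree
  \<open>n + 2\<close> by solving \<open>d w = - der deg t (d (gvar y))\<close>. Solvability rests
  on \<open>exact\<close> in positive degrees; in degree 0 it rests on \<open>exact_0\<close> and on
  \<open>relation\<close>, through which the free summand enters.\<close>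

lemma lifts_upto_exists:
  assumes fin: "finite (vars_in_degree X deg 1)"
    and exact: "\<And>i z. 1 \<le> i \<Longrightarrow> z \<in> gpart X deg i \<Longrightarrow> d z = 0 \<Longrightarrow> \<exists>w\<in>gpart X deg (Suc i). d w = z"
    and exact_0: "\<And>r. r \<in> I \<Longrightarrow> \<exists>w\<in>gpart X deg 1. d w = gconst r"
    and x\<^sub>1: "x\<^sub>1 \<in> vars_in_degree X deg 1"
    and relation: "\<And>c. (\<Sum>x\<in>vars_in_degree X deg 1. c x * cf (d (gvar x)) {#}) = 0 \<Longrightarrow> c x\<^sub>1 \<in> I"
  shows "\<exists>t. lifts_upto x\<^sub>1 n t"
proof (induction n)
  case 0
  define t :: "'x \<Rightarrow> ('x, 'a) gpoly" where "t z = (if z = x\<^sub>1 then gconst 1 else 0)" for z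
  have "t z \<in> gpart X deg (deg z - 1)" for z
    using x\<^sub>1 gconst_gpart[of "1 :: 'a" X deg] by (simp add: t_def vars_in_degree_def)
  \<comment> \<open>In degree 1 both sides are 0: \<open>t y\<close> is constant, and
    \<open>der\<close> kills the constant \<open>d (gvar y)\<close>.\<close>
  moreover have "d (t y) = - der deg t (d (gvar y))" if "y \<in> X" "deg y \<le> Suc 0" for y
    using d_gvar[OF that(1)] that(2) der_gpart_0[of "d (gvar y)" t]
    by (simp add: t_def d_gconst d_zero)
  ultimately have "lifts_upto x\<^sub>1 0 t"
    by (simp add: lifts_upto_def t_def)
  then show ?case by (rule exI[of _ t])
next
  case (Suc n)
  then obtain t where lifts: "lifts_upto x\<^sub>1 n t" ..
  have t_gpart: "\<And>z. z \<in> X \<Longrightarrow> t z \<in> gpart X deg (deg z - 1)"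
    and t_1: "\<And>z. z \<in> vars_in_degree X deg 1 \<Longrightarrow> t z = (if z = x\<^sub>1 then gconst 1 else 0)"
    and t_d: "\<And>y. y \<in> X \<Longrightarrow> deg y \<le> Suc n \<Longrightarrow> d (t y) = - der deg t (d (gvar y))"
    using lifts by (simp_all add: lifts_upto_def)
  interpret dg_derivation X deg d t by unfold_locales (rule t_gpart)
  have "\<exists>w\<in>gpart X deg (Suc n). d w = - der deg t (d (gvar y))" if "y \<in> X" "deg y = Suc (Suc n)" for y
  proof -
    have dy: "d (gvar y) \<in> gpart X deg (Suc n)" using d_gvar[OF that(1)] that(2) by simp
    then have z: "der deg t (d (gvar y)) \<in> gpart X deg n"
      by (intro der_gpart[of X] t_gpart deg_pos)
    have "\<exists>w\<in>gpart X deg (Suc n). d w = der deg t (d (gvar y))"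
    proof (cases n)
      case 0
      \<comment> \<open>Here \<open>y\<close> has degree 2, and \<open>exact\<close> says nothing
        about cycles of degree 0. Writing \<open>d (gvar y)\<close> as a combination of degree-one
        variables, \<open>d (d (gvar y)) = 0\<close> becomes a relation among the generators. Its
        coefficient at \<open>x\<^sub>1\<close> is the constant
        \<open>der deg t (d (gvar y))\<close>, a boundary because it lies in
        \<open>I\<close>.\<close>
      define c where "c x = cf (d (gvar y)) {#x#}" for x
      let ?V = "vars_in_degree X deg 1"
      have V: "x \<in> X" "deg x = 1" if "x \<in> ?V" for x using that by (simp_all add: vars_in_degree_def)
      have eq: "d (gvar y) = (\<Sum>x\<in>?V. gsmult (c x) (gvar x))"
        using gpart_1_eq[OF _ fin] dy 0 by (simp add: c_def)
      have "d (d (gvar y)) = (\<Sum>x\<in>?V. gsmult (c x) (d (gvar x)))"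
        unfolding eq using V by (simp add: d_sum d_gsmult gvar_galg galg_gsmult)
      then have "(\<Sum>x\<in>?V. gsmult (c x) (d (gvar x))) = 0"
        using d_d[OF gvar_galg[OF that(1)]] by simp
      then have "cf (\<Sum>x\<in>?V. gsmult (c x) (d (gvar x))) {#} = 0" by simp
      then have "c x\<^sub>1 \<in> I" by (intro relation) (simp add: lookup_sum)
      have der_sum: "der deg t (\<Sum>x\<in>A. f x) = (\<Sum>x\<in>A. der deg t (f x))" for A and f :: "'x \<Rightarrow> ('x, 'a) gpoly"
        by (induction A rule: infinite_finite_induct) (simp_all add: der_add)
      have "der deg t (d (gvar y)) = (\<Sum>x\<in>?V. gsmult (c x) (t x))"
        unfolding eq using V by (simp add: der_sum der_gsmult der_gvar_eq)
      also have "\<dots> = (\<Sum>x\<in>?V. if x = x\<^sub>1 then gconst (c x\<^sub>1) else 0)"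
        by (rule sum.cong) (simp_all add: t_1 gconst_def del: single_one)
      also have "\<dots> = gconst (c x\<^sub>1)" using fin x\<^sub>1 by simp
      finally show ?thesis using exact_0[OF \<open>c x\<^sub>1 \<in> I\<close>] 0 by simp
    next
      case (Suc m)
      \<comment> \<open>For degree reasons only variables of degree at most \<open>n + 1\<close>
        occur in \<open>d (gvar y)\<close>, so the anticommutation already achieved shows that
        \<open>der deg t (d (gvar y))\<close> is a cycle.\<close>
      let ?Y = "{z \<in> X. deg z \<le> Suc n}"
      have "d (gvar y) \<in> galg ?Y deg"
        unfolding galg_def
      proof (clarify)
        fix M assume "M \<in> Poly_Mapping.keys (d (gvar y))"
        with dy have "M \<in> monomials X deg" "mdeg deg M = Suc n" by (auto simp: gpart_iff)
        then show "M \<in> monomials ?Y deg"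
          using mdeg_ge[of _ M deg] by (auto simp: monomials_def)
      qed
      then have "d (der deg t (d (gvar y))) = - der deg t (d (d (gvar y)))"
        by (intro d_der_anticommute[of ?Y]) (auto simp: t_d)
      also have "\<dots> = 0" using d_d[OF gvar_galg[OF that(1)]] by simp
      finally show ?thesis using exact[OF _ z] Suc by simp
    qed
    then obtain w where "w \<in> gpart X deg (Suc n)" "d w = der deg t (d (gvar y))" ..
    then show ?thesis
      by (intro bexI[of _ "- w"]) (simp_all add: d_uminus gpart_galg gpart_uminus)
  qed
  then have "\<forall>y\<in>{y \<in> X. deg y = Suc (Suc n)}.
      \<exists>w. w \<in> gpart X deg (Suc n) \<and> d w = - der deg t (d (gvar y))" by auto
  from bchoice[OF this] obtain w where w: "\<And>y. y \<in> X \<Longrightarrow> deg y = Suc (Suc n) \<Longrightarrow>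
      w y \<in> gpart X deg (Suc n) \<and> d (w y) = - der deg t (d (gvar y))" by auto
  define t' where "t' y = (if deg y = Suc (Suc n) then w y else t y)" for y
  \<comment> \<open>The variables occurring in \<open>d (gvar y)\<close> have smaller degree than
    \<open>y\<close>, so the new values do not disturb the equations of earlier stages.\<close>
  have der_t': "der deg t' (d (gvar y)) = der deg t (d (gvar y))" if "y \<in> X" "deg y \<le> Suc (Suc n)" for y
  proof (rule der_cong)
    fix M z assume "M \<in> Poly_Mapping.keys (d (gvar y))" "z \<in># M"
    with d_gvar[OF that(1)] mdeg_ge[of z M deg] have "deg z \<le> deg y - 1" by (auto simp: gpart_iff)
    with that(2) have "deg z \<noteq> Suc (Suc n)" by simp
    then show "t' z = t z" by (simp add: t'_def)
  qed
  have "t' z \<in> gpart X deg (deg z - 1)" if "z \<in> X" for z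
    using w[OF that] t_gpart[OF that] by (simp add: t'_def)
  moreover have "t' z = (if z = x\<^sub>1 then gconst 1 else 0)" if "z \<in> vars_in_degree X deg 1" for z
    using t_1[OF that] that by (simp add: t'_def vars_in_degree_def)
  moreover have "d (t' y) = - der deg t' (d (gvar y))" if "y \<in> X" "deg y \<le> Suc (Suc n)" for y
    using w[OF that(1)] t_d[OF that(1)] that(2) by (auto simp: der_t'[OF that] t'_def)
  ultimately have "lifts_upto x\<^sub>1 (Suc n) t'"
    by (simp add: lifts_upto_def)
  then show ?case by (rule exI[of _ t'])
qed

end

section \<open>Reading off a quadratic coefficient\<close>

context dg_derivation
begin

text \<open>Among the values of \<open>t\<close> only \<open>t x\<^sub>1 = 1\<close> has a constant
  term. Hence the coefficient of \<open>x'\<close> in \<open>der deg t p\<close> consists of the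
  coefficient of \<open>x\<^sub>1 x'\<close> in \<open>p\<close>, up to sign, and of multiples of
  linear coefficients of \<open>p\<close>, which lie in \<open>J\<close>.\<close>

lemma quadratic_coeff_in_ideal:
  assumes J: "ideal J" and p: "p \<in> galg X deg" "p \<in> linear_part_in J"
    and x\<^sub>1: "x\<^sub>1 \<in> X" "deg x\<^sub>1 = 1"
    and t_1: "\<And>z. z \<in> vars_in_degree X deg 1 \<Longrightarrow> t z = (if z = x\<^sub>1 then gconst 1 else 0)"
    and x': "x' \<in> X" "x' \<noteq> x\<^sub>1"
    and der: "cf (der deg t p) {#x'#} \<in> J"
  shows "cf p {#x\<^sub>1, x'#} \<in> J"
proof (cases "{#x\<^sub>1, x'#} \<in> Poly_Mapping.keys p")
  case False
  then show ?thesis by (simp add: in_keys_iff ideal_zero[OF J])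
next
  case True
  let ?Q = "{#x\<^sub>1, x'#}"
  have t_const: "cf (t z) {#} = (if z = x\<^sub>1 then 1 else 0)" if "z \<in> X" for z
  proof (cases "deg z = 1")
    case True
    with that t_1[of z] show ?thesis
      by (simp add: vars_in_degree_def gconst_def del: single_one)
  next
    case False
    \<comment> \<open>For \<open>deg z \<ge> 2\<close> the degree of \<open>t z\<close> is positive,
      which rules out a constant term.\<close>
    with deg_pos[OF that] have "deg z - 1 \<noteq> 0" by simp
    with t[OF that] have "{#} \<notin> Poly_Mapping.keys (t z)" by (auto simp: gpart_iff)
    with False x\<^sub>1(2) show ?thesis by (auto simp: in_keys_iff)
  qed
  define c where "c M z = mono_coeff deg {#z#} (M - {#z#}) * cf p M" for M z
  define f where "f M z = cf (gmult deg (t z) (gmono (M - {#z#}) (c M z))) {#x'#}" for M z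
  have f: "f M z = (if z = x\<^sub>1 \<and> M - {#z#} = {#x'#} then c M z else 0) +
      (if M - {#z#} = {#} then cf (t z) {#x'#} * c M z else 0)" if "z \<in> X" for M z
    using t_const[OF that] by (simp add: f_def cf_gmult_single lookup_single when_def)
  have keys_X: "set_mset M \<subseteq> X" if "M \<in> Poly_Mapping.keys p" for M
    using that p(1) by (auto simp: galg_def monomials_def)
  have der_eq: "cf (der deg t p) {#x'#} = (\<Sum>M\<in>Poly_Mapping.keys p. \<Sum>z\<in>#M. f M z)"
  proof -
    have "cf (\<Sum>z\<in>#M. g z) N = (\<Sum>z\<in>#M. cf (g z) N)" for M N and g :: "'x \<Rightarrow> ('x, 'a) gpoly"
      by (induction M) (simp_all add: lookup_add)
    then show ?thesis by (simp add: der_def lookup_sum f_def c_def)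
  qed
  \<comment> \<open>Any other monomial contributes to \<open>x'\<close> only if it is a single
    variable, and then its coefficient in \<open>p\<close> lies in \<open>J\<close>.\<close>
  have other: "(\<Sum>z\<in>#M. f M z) \<in> J" if M: "M \<in> Poly_Mapping.keys p" "M \<noteq> ?Q" for M
  proof (rule ideal_sum_mset[OF J])
    fix z assume z: "z \<in># M"
    then have "\<not> (z = x\<^sub>1 \<and> M - {#z#} = {#x'#})" using M(2) by (metis insert_DiffM)
    moreover have "cf (t z) {#x'#} * c M z \<in> J" if "M - {#z#} = {#}"
    proof -
      have "M = {#z#}" using z that by (metis insert_DiffM)
      then have "cf p M \<in> J" using p(2) by (simp add: linear_part_in_def)
      then show ?thesis unfolding c_def by (intro ideal_mult_left[OF J])
    qed
    ultimately show "f M z \<in> J"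
      using f[of z M] keys_X[OF M(1)] z ideal_zero[OF J] by auto
  qed
  have "f ?Q x\<^sub>1 = c ?Q x\<^sub>1" "f ?Q x' = 0" using f x\<^sub>1 x' by auto
  then have "cf (der deg t p) {#x'#} = c ?Q x\<^sub>1 + (\<Sum>M\<in>Poly_Mapping.keys p - {?Q}. \<Sum>z\<in>#M. f M z)"
    unfolding der_eq using True by (subst sum.remove[of _ ?Q]) simp_all
  then have "c ?Q x\<^sub>1 = cf (der deg t p) {#x'#} +
      (-1) * (\<Sum>M\<in>Poly_Mapping.keys p - {?Q}. \<Sum>z\<in>#M. f M z)" by simp
  moreover have "(\<Sum>M\<in>Poly_Mapping.keys p - {?Q}. \<Sum>z\<in>#M. f M z) \<in> J"
    using other by (intro ideal_sum[OF J]) simp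
  ultimately have "c ?Q x\<^sub>1 \<in> J"
    using der by (simp only: ideal_add[OF J] ideal_mult_left[OF J])
  \<comment> \<open>Multiplying by the sign once more recovers the coefficient of
    \<open>p\<close>.\<close>
  then have "mono_coeff deg {#x\<^sub>1#} {#x'#} * c ?Q x\<^sub>1 \<in> J" by (rule ideal_mult_left[OF J])
  moreover have "?Q \<in> monomials UNIV deg"
    using True p(1) by (auto simp: galg_def intro: monomials_UNIV)
  then have "mono_coeff deg {#x\<^sub>1#} {#x'#} * mono_coeff deg {#x\<^sub>1#} {#x'#} = (1 :: 'a)"
    by (intro mono_coeff_square) (simp add: add_mset_commute)
  ultimately show ?thesis
    by (simp add: c_def flip: mult.assoc)
qed

end

section \<open>Relations among the generators\<close>

text \<open>Passing to classes turns the relation into \<open>f + g = 0\<close> with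
  \<open>f \<in> F\<close> and \<open>g \<in> G\<close>. The sum is direct, so \<open>f = 0\<close>,
  and independence of the basis of \<open>F\<close> forces \<open>\<phi> (r c) = 0\<close>.\<close>

lemma conormal_relation:
  fixes I :: "'a::comm_ring_1 set" and scale :: "'s::comm_ring_1 \<Rightarrow> 'v::ab_group_add \<Rightarrow> 'v"
  assumes I: "ideal I" and S: "quotient_ring_map I \<phi>" and conormal: "conormal_module \<phi> I scale cl"
    and summand: "complementary_submodules scale F G"
    and fin: "finite A" "finite B" "A \<inter> B = {}" and sub: "A \<subseteq> I" "B \<subseteq> I"
    and F: "inj_on cl A" "basis_of scale (cl ` A) F"
    and G: "cl ` B \<subseteq> G"
    and rel: "(\<Sum>c\<in>A \<union> B. r c * c) = 0" and c: "c \<in> A"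
  shows "r c \<in> I"
proof -
  interpret module scale using conormal by (simp add: conormal_module_def)
  have cl_add: "x \<in> I \<Longrightarrow> y \<in> I \<Longrightarrow> cl (x + y) = cl x + cl y"
    and cl_mult: "x \<in> I \<Longrightarrow> cl (s * x) = scale (\<phi> s) (cl x)" for x y s
    using conormal by (simp_all add: conormal_module_def)
  have cl_0: "cl 0 = 0" using cl_add[of 0 0] ideal_zero[OF I] by simp
  have cl_sum: "cl (\<Sum>c\<in>C. r c * c) = (\<Sum>c\<in>C. scale (\<phi> (r c)) (cl c))" if "finite C" "C \<subseteq> I" for C
    using that
  proof (induction C rule: finite_induct)
    case (insert x C)
    then have "r x * x \<in> I" "(\<Sum>c\<in>C. r c * c) \<in> I"
      by (auto intro!: ideal_sum[OF I] ideal_mult_left[OF I])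
    with insert show ?case by (simp add: cl_add cl_mult)
  qed (simp add: cl_0)
  define f where "f = (\<Sum>c\<in>A. scale (\<phi> (r c)) (cl c))"
  define g where "g = (\<Sum>c\<in>B. scale (\<phi> (r c)) (cl c))"
  have subspaces: "subspace F" "subspace G" "F \<inter> G = {0}"
    using summand by (simp_all add: complementary_submodules_def)
  have "cl ` A \<subseteq> F" using F(2) span_superset[of "cl ` A"] by (simp add: basis_of_def)
  then have "f \<in> F" unfolding f_def
    using subspaces(1) by (intro subspace_sum subspace_scale) auto
  moreover have "g \<in> G" unfolding g_def
    using subspaces(2) G by (intro subspace_sum subspace_scale) auto
  moreover have "f + g = 0"
    using cl_sum[of "A \<union> B"] rel fin sub by (simp add: f_def g_def cl_0 sum.union_disjoint)
  then have "f = - g" by (simp add: eq_neg_iff_add_eq_0)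
  ultimately have "f \<in> F \<inter> G" using subspace_neg[OF subspaces(2)] by auto
  then have "f = 0" using subspaces(3) by simp
  \<comment> \<open>Independence concerns coefficients indexed by vectors; injectivity of
    \<open>cl\<close> on \<open>A\<close> lets the coefficients be transported from the generators
    to their classes.\<close>
  define u where "u v = \<phi> (r (the_inv_into A cl v))" for v
  have u: "u (cl c') = \<phi> (r c')" if "c' \<in> A" for c'
    using that F(1) by (simp add: u_def the_inv_into_f_f)
  have "(\<Sum>v\<in>cl ` A. scale (u v) v) = f"
    using F(1) u by (simp add: sum.reindex f_def)
  with \<open>f = 0\<close> have "u (cl c) = 0"
    using F(2) c fin(1) by (intro independentD[of "cl ` A" "cl ` A"]) (auto simp: basis_of_def)
  with u[OF c] S show ?thesis by (auto simp: quotient_ring_map_def)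
qed


section \<open>Minimal models\<close>

lemma quasi_isomorphism_boundaryD:
  assumes "quasi_isomorphism C d E e f" "z \<in> cycles C d i" "f z \<in> boundaries E e i"
  shows "z \<in> boundaries C d i"
  using assms by (simp add: quasi_isomorphism_def)

text \<open>The target complex is zero in positive degrees, so injectivity on homology applies to
  every cycle.\<close>

lemma minimal_model_exact:
  assumes model: "minimal_model \<mm> I \<phi> X deg d \<epsilon>" and z: "1 \<le> i" "z \<in> gpart X deg i" "d z = 0"
  shows "\<exists>w\<in>gpart X deg (Suc i). d w = z"
proof -
  have qi: "quasi_isomorphism (gpart X deg) d concentrated_in_degree_0 (\<lambda>_. 0) \<epsilon>"
    using model by (simp add: minimal_model_def)
  have "\<epsilon> ` gpart X deg i \<subseteq> concentrated_in_degree_0 i"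
    using qi by (simp add: quasi_isomorphism_def)
  then have "\<epsilon> z = 0" using z by (auto simp: concentrated_in_degree_0_def)
  then have "\<epsilon> z \<in> boundaries concentrated_in_degree_0 (\<lambda>_. 0) i"
    by (simp add: boundaries_def concentrated_in_degree_0_def)
  moreover have "z \<in> cycles (gpart X deg) d i" using z by (simp add: cycles_def)
  ultimately have "z \<in> boundaries (gpart X deg) d i"
    by (intro quasi_isomorphism_boundaryD[OF qi])
  then show ?thesis by (auto simp: boundaries_def)
qed

text \<open>The constant \<open>gconst r\<close> is a cycle with image \<open>\<phi> r = 0\<close>,
  so injectivity on homology in degree 0 applies.\<close>

lemma minimal_model_exact_0:
  assumes model: "minimal_model \<mm> I \<phi> X deg d \<epsilon>" and S: "quotient_ring_map I \<phi>" and r: "r \<in> I"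
  shows "\<exists>w\<in>gpart X deg 1. d w = gconst r"
proof -
  have qi: "quasi_isomorphism (gpart X deg) d concentrated_in_degree_0 (\<lambda>_. 0) \<epsilon>"
    and "\<epsilon> (gconst r) = \<phi> r" and dg: "dg_differential X deg d"
    using model by (simp_all add: minimal_model_def algebra_map_over_def)
  then have "\<epsilon> (gconst r) \<in> boundaries concentrated_in_degree_0 (\<lambda>_. 0) 0"
    using r S by (auto simp: boundaries_def concentrated_in_degree_0_def quotient_ring_map_def)
  moreover have "gconst r \<in> cycles (gpart X deg) d 0"
    using dg gconst_gpart[of r X deg] by (simp add: cycles_def dg_differential_def)
  ultimately have "gconst r \<in> boundaries (gpart X deg) d 0"
    by (intro quasi_isomorphism_boundaryD[OF qi])
  then show ?thesis by (auto simp: boundaries_def)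
qed

text \<open>In degree 1 the differential of a variable is a constant from a generating set of
  \<open>I\<close>; in higher degrees minimality puts it into the square of the ideal
  \<open>(X, \<mm>)\<close>.\<close>

lemma minimal_model_linear_part:
  assumes model: "minimal_model \<mm> I \<phi> X deg d \<epsilon>" and \<mm>: "ideal \<mm>" "I \<subseteq> \<mm>" and x: "x \<in> X"
  shows "d (gvar x) \<in> linear_part_in \<mm>"
proof -
  interpret dg_polynomials X deg d
    using model by unfold_locales (simp_all add: minimal_model_def)
  show ?thesis
  proof (cases "deg x = 1")
    case True
    let ?E = "(\<lambda>x. cf (d (gvar x)) {#}) ` vars_in_degree X deg 1"
    have "ideal_span ?E = I"
      using model by (simp add: minimal_model_def minimally_generates_def)
    then have "cf (d (gvar x)) {#} \<in> \<mm>"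
      using module.span_superset[OF module_times, of ?E] \<mm>(2) x True
      by (auto simp: vars_in_degree_def)
    moreover have "d (gvar x) = gconst (cf (d (gvar x)) {#})"
      using gpart_0_eq[of "d (gvar x)"] d_gvar[OF x] True by simp
    then have "cf (d (gvar x)) {#z#} = 0" for z
      by (metis gconst_def lookup_single_not_eq empty_not_add_mset)
    ultimately show ?thesis using ideal_zero[OF \<mm>(1)] by (simp add: linear_part_in_def)
  next
    case False
    with deg_pos[OF x] model x
    have "d (gvar x) \<in> gideal_square X deg (gideal X deg (gvar ` X \<union> gconst ` \<mm>))"
      by (auto simp: minimal_model_def)
    then show ?thesis
    proof (rule gideal_square_linear_part_in[OF \<mm>(1), rotated])
      fix p assume "p \<in> gideal X deg (gvar ` X \<union> gconst ` \<mm>)"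
      then show "cf p {#} \<in> \<mm>"
        using ideal_zero[OF \<mm>(1)]
        by (elim gideal_const_in[OF \<mm>(1), rotated])
           (auto simp: gvar_def gconst_def lookup_single simp del: single_one)
    qed
  qed
qed

text \<open>By minimality \<open>d (t y)\<close> has no linear part modulo \<open>\<mm>\<close>. It
  equals \<open>- der deg t (d (gvar y))\<close>, whose coefficient at \<open>x'\<close> detects the
  coefficient in question.\<close>

lemma minimal_model_quadratic_coeff:
  assumes model: "minimal_model \<mm> I \<phi> X deg d \<epsilon>" and S: "quotient_ring_map I \<phi>"
    and \<mm>: "ideal \<mm>" "I \<subseteq> \<mm>"
    and x\<^sub>1: "x\<^sub>1 \<in> vars_in_degree X deg 1"
    and relation: "\<And>c. (\<Sum>x\<in>vars_in_degree X deg 1. c x * cf (d (gvar x)) {#}) = 0 \<Longrightarrow> c x\<^sub>1 \<in> I"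
    and x': "x' \<in> X" and y: "y \<in> X"
  shows "cf (d (gvar y)) {#x\<^sub>1, x'#} \<in> \<mm>"
proof -
  interpret dg_polynomials X deg d
    using model by unfold_locales (simp_all add: minimal_model_def)
  have x\<^sub>1': "x\<^sub>1 \<in> X" "deg x\<^sub>1 = 1" using x\<^sub>1 by (simp_all add: vars_in_degree_def)
  have dy: "d (gvar y) \<in> galg X deg" using gpart_galg[OF d_gvar[OF y]] .
  show ?thesis
  proof (cases "x' = x\<^sub>1")
    case True
    \<comment> \<open>The odd variable \<open>x\<^sub>1\<close> cannot be repeated in a
      monomial.\<close>
    have "{#x\<^sub>1, x\<^sub>1#} \<notin> monomials X deg"
      using monomials_add_even[of "{#x\<^sub>1#}" "{#x\<^sub>1#}" X deg x\<^sub>1] x\<^sub>1'(2) by auto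
    with dy have "{#x\<^sub>1, x'#} \<notin> Poly_Mapping.keys (d (gvar y))"
      using True by (auto simp: galg_def)
    then show ?thesis by (simp add: in_keys_iff ideal_zero[OF \<mm>(1)])
  next
    case False
    have "finite (vars_in_degree X deg 1)" using model by (simp add: minimal_model_def)
    \<comment> \<open>Stage \<open>deg y\<close> covers all variables of degree up to
      \<open>deg y + 1\<close>, in particular \<open>y\<close>. As \<open>y\<close> is fixed, a
      finite stage of the construction suffices.\<close>
    then have "\<exists>t. lifts_upto x\<^sub>1 (deg y) t"
      using minimal_model_exact[OF model] minimal_model_exact_0[OF model S] x\<^sub>1 relation
      by (rule lifts_upto_exists)
    then obtain t where lifts: "lifts_upto x\<^sub>1 (deg y) t" by blast
    interpret dg_derivation X deg d t
      using lifts by unfold_locales (simp add: lifts_upto_def)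
    have "d (t y) \<in> linear_part_in \<mm>"
      by (rule d_linear_part_in[OF \<mm>(1) minimal_model_linear_part[OF model \<mm>] gpart_galg[OF t[OF y]]])
    then have "(-1) * cf (d (t y)) {#x'#} \<in> \<mm>"
      by (intro ideal_mult_left[OF \<mm>(1)]) (simp add: linear_part_in_def)
    moreover have "d (t y) = - der deg t (d (gvar y))"
      using lifts y by (simp add: lifts_upto_def)
    ultimately have "cf (der deg t (d (gvar y))) {#x'#} \<in> \<mm>" by simp
    then show ?thesis
    proof (rule quadratic_coeff_in_ideal[OF \<mm>(1) dy minimal_model_linear_part[OF model \<mm> y] x\<^sub>1' _ x' False, rotated])
      fix z assume "z \<in> vars_in_degree X deg 1"
      then show "t z = (if z = x\<^sub>1 then gconst 1 else 0)"
        using lifts by (simp add: lifts_upto_def)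
    qed
  qed
qed


section \<open>Centrality\<close>

lemma cf_quadratic_part: "size M = 2 \<Longrightarrow> cf (quadratic_part p) M = cf p M"
  by (cases "M \<in> Poly_Mapping.keys p")
     (auto simp: quadratic_part_def lookup_sum lookup_single when_def in_keys_iff)

text \<open>For either order of \<open>x\<close> and \<open>x'\<close>, the symmetrized coefficient
  is a multiple of the reduction of the coefficient of \<open>x x'\<close>.\<close>

lemma symmetrization_coeff_eq_0:
  assumes "\<rho> 0 = 0" "\<rho> (cf p {#x, x'#}) = 0"
  shows "symmetrization_coeff deg (quadratic_part (base_change \<rho> p)) x x' = 0"
proof -
  have "cf (quadratic_part (base_change \<rho> p)) {#x, x'#} = 0"
    using assms by (simp add: cf_quadratic_part base_change_def Poly_Mapping.map.rep_eq when_def)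
  then show ?thesis by (auto simp: symmetrization_coeff_def)
qed

text \<open>The bracket is defined by bilinear expansion, so centrality can be tested on dual basis
  vectors.\<close>

lemma central_dual_var:
  assumes "x \<in> X" "\<And>x'. x' \<in> X \<Longrightarrow> basis_bracket \<rho> X deg d x x' = 0"
  shows "central \<rho> X deg d (dual_var x)"
proof -
  have "Poly_Mapping.map f 0 = 0" for f :: "'b \<Rightarrow> 'b"
    by (rule poly_mapping_eqI) (simp add: Poly_Mapping.map.rep_eq)
  then show ?thesis
    using assms
    by (auto simp: central_def homotopy_lie_algebra_def lie_bracket_def dual_var_def subset_iff
        intro!: sum.neutral)
qed

theorem corollary4p3:
  fixes \<mm> I :: "'a::comm_ring_1 set"
    and \<rho> :: "'a \<Rightarrow> 'k::field"
    and \<phi> :: "'a \<Rightarrow> 's::comm_ring_1"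
    and scale :: "'s \<Rightarrow> 'v::ab_group_add \<Rightarrow> 'v"
    and cl :: "'a \<Rightarrow> 'v"
    and F G :: "'v set"
    and a b :: "'a list"
    and X :: "'x::linorder set"
    and deg :: "'x \<Rightarrow> nat"
    and d :: "('x, 'a) gpoly \<Rightarrow> ('x, 'a) gpoly"
    and \<epsilon> :: "('x, 'a) gpoly \<Rightarrow> 's"
    and x :: "nat \<Rightarrow> 'x"
  assumes R: "noetherian_local_ring \<mm>"
    and k: "quotient_ring_map \<mm> \<rho>"
    and I: "ideal I" "I \<noteq> UNIV"
    and S: "quotient_ring_map I \<phi>"
    and conormal: "conormal_module \<phi> I scale cl"
    and summand: "complementary_submodules scale F G"
    and gens: "distinct (a @ b)" "minimally_generates (*) (set (a @ b)) I"
    and F: "distinct (map cl a)" "basis_of scale (set (map cl a)) F"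
    and G: "distinct (map cl b)" "minimally_generates scale (set (map cl b)) G"
    and model: "minimal_model \<mm> I \<phi> X deg d \<epsilon>"
    and X1: "bij_betw (\<lambda>x. d (gvar x)) (vars_in_degree X deg 1) (gconst ` set (a @ b))"
    and x: "\<And>i. i < length a \<Longrightarrow> x i \<in> vars_in_degree X deg 1"
      "\<And>i. i < length a \<Longrightarrow> d (gvar (x i)) = gconst (a ! i)"
  shows "\<forall>i<length a. central \<rho> X deg d (dual_var (x i))"
proof (intro allI impI)
  fix i assume i: "i < length a"
  let ?V = "vars_in_degree X deg 1"
  \<comment> \<open>\<open>e\<close> sends a degree-one variable to the generator of
    \<open>I\<close> that is its differential, read off as a constant coefficient.\<close>
  define e where "e z = cf (d (gvar z)) {#}" for z
  have cf_gconst: "cf (gconst r) {#} = r" for r :: 'a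
    by (simp add: gconst_def del: single_one)
  have "bij_betw (\<lambda>p. cf p {#}) (gconst ` set (a @ b)) (set (a @ b))"
    by (rule bij_betw_byWitness[where f' = gconst]) (auto simp: cf_gconst)
  from bij_betw_trans[OF X1 this] have e: "bij_betw e ?V (set (a @ b))"
    by (simp add: e_def[abs_def] comp_def)
  have e_x: "e (x i) = a ! i" using x(2)[OF i] by (simp add: e_def cf_gconst)
  have \<mm>: "ideal \<mm>" "I \<subseteq> \<mm>"
    using R proper_ideal_subset_local[OF R I] by (simp_all add: noetherian_local_ring_def maximal_ideal_def)
  have gens_I: "set (a @ b) \<subseteq> I"
    using gens(2) module.span_superset[OF module_times, of "set (a @ b)"]
    by (simp add: minimally_generates_def)
  interpret cm: module scale using conormal by (simp add: conormal_module_def)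
  have "cl ` set b \<subseteq> G"
    using G(2) cm.span_superset[of "cl ` set b"] by (simp add: minimally_generates_def)
  have relation: "c (x i) \<in> I" if "(\<Sum>z\<in>?V. c z * cf (d (gvar z)) {#}) = 0" for c
  proof -
    \<comment> \<open>The coefficients are relabelled by generators along \<open>e\<close>, which
      brings the relation into the form of \<open>conormal_relation\<close>; the variable
      \<open>x i\<close> corresponds to \<open>a ! i\<close>.\<close>
    define r where "r g = c (the_inv_into ?V e g)" for g
    have r: "r (e z) = c z" if "z \<in> ?V" for z
      using that e by (simp add: r_def bij_betw_def the_inv_into_f_f)
    have "(\<Sum>g\<in>set (a @ b). r g * g) = (\<Sum>z\<in>?V. r (e z) * e z)"
      by (rule sum.reindex_bij_betw[OF e, symmetric])
    also have "\<dots> = 0" using that r by (simp add: e_def)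
    finally have "(\<Sum>g\<in>set a \<union> set b. r g * g) = 0" by simp
    then have "r (a ! i) \<in> I"
      using gens(1) gens_I F i \<open>cl ` set b \<subseteq> G\<close>
      by (intro conormal_relation[OF I(1) S conormal summand, of "set a" "set b"])
         (auto simp: distinct_map)
    with r[OF x(1)[OF i]] e_x show ?thesis by simp
  qed
  have \<rho>: "\<rho> r = 0" if "r \<in> \<mm>" for r
    using k that by (auto simp: quotient_ring_map_def)
  show "central \<rho> X deg d (dual_var (x i))"
  proof (rule central_dual_var)
    show "x i \<in> X" using x(1)[OF i] by (simp add: vars_in_degree_def)
  next
    fix x' assume x': "x' \<in> X"
    \<comment> \<open>The multiset \<open>{#x i, x'#}\<close> is unordered, so both orders of
      \<open>x i\<close> and \<open>x'\<close> are covered.\<close>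
    have "cf (d (gvar y)) {#x i, x'#} \<in> \<mm>" if "y \<in> X" for y
      by (rule minimal_model_quadratic_coeff[OF model S \<mm> x(1)[OF i] _ x' that]) (rule relation)
    then have "symmetrization_coeff deg (quadratic_part (base_change \<rho> (d (gvar y)))) (x i) x' = 0"
      if "y \<in> X" for y
      using that by (intro symmetrization_coeff_eq_0 \<rho> ideal_zero[OF \<mm>(1)])
    then show "basis_bracket \<rho> X deg d (x i) x' = 0"
      by (auto simp: basis_bracket_def vars_in_degree_def intro!: sum.neutral)
  qed
qed

end
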